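(* Let $X$ be a real hereditarily indecomposable (HI) Banach space. Then $\mathrm{Id}_X$ cannot be homotopic to a reflection in $\mathrm{GL}(X)$; that is, for every reflection $R$ of $X$ there is no continuous map $[0,1]\to\mathrm{GL}(X)$, $t\mapsto T_t$, with $T_0=\mathrm{Id}_X$ and $T_1=R$.
   Context: Banach spaces are infinite-dimensional. A subspace of a Banach space means an infinite-dimensional closed subspace; operators are bounded and linear; hyperplanes are closed subspaces of codimension $1$. A Banach space is hereditarily indecomposable (HI) if it contains no topological direct sum of two subspaces, i.e. there are no infinite-dimensional closed subspaces $Y,Z$ with $Y\cap Z=\{0\}$ and $Y+Z$ closed. $\mathcal{L}(X)$ is the algebra of operators on $X$ and $\mathrm{GL}(X)$ its group of invertible elements, both with the operator norm topology. A reflection of $X$ is an operator $R\in\mathcal{L}(X)$ for which there exist a hyperplane $H\subseteq X$ and $x_0\in X\setminus\{0\}$ with $R(x)=x$ for all $x\in H$ and $R(x_0)=-x_0$. *)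

theory Defs
  imports "HOL-Analysis.Analysis"
begin

definition infinite_dimensional :: "'a::real_vector set \<Rightarrow> bool" where
  "infinite_dimensional Y \<longleftrightarrow> \<not> (\<exists>B. finite B \<and> Y \<subseteq> span B)"

definition banach_subspace :: "'a::real_normed_vector set \<Rightarrow> bool" where
  "banach_subspace Y \<longleftrightarrow> subspace Y \<and> closed Y \<and> infinite_dimensional Y"

text \<open>The ambient space is a whole type of class \<open>banach\<close>, and Banach spaces are understood
  to be infinite-dimensional; this convention is part of the definition of an HI space.\<close>

definition hereditarily_indecomposable :: "'a::banach itself \<Rightarrow> bool" where
  "hereditarily_indecomposable _ \<longleftrightarrow>
     infinite_dimensional (UNIV :: 'a set) \<and>
     \<not> (\<exists>Y Z :: 'a set. banach_subspace Y \<and> banach_subspace Z \<and>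
          Y \<inter> Z = {0} \<and> closed {y + z | y z. y \<in> Y \<and> z \<in> Z})"

text \<open>Codimension 1: the quotient by \<open>H\<close> is spanned by the class of one vector outside \<open>H\<close>.\<close>

definition hyperplane :: "'a::real_normed_vector set \<Rightarrow> bool" where
  "hyperplane H \<longleftrightarrow> subspace H \<and> closed H \<and> (\<exists>v. v \<notin> H \<and> span (insert v H) = UNIV)"

definition reflection :: "('a::real_normed_vector \<Rightarrow>\<^sub>L 'a) \<Rightarrow> bool" where
  "reflection R \<longleftrightarrow>
     (\<exists>H x0. hyperplane H \<and> x0 \<noteq> 0 \<and>
        (\<forall>x\<in>H. blinfun_apply R x = x) \<and> blinfun_apply R x0 = - x0)"

text \<open>The norm on \<open>'a \<Rightarrow>\<^sub>L 'a\<close> is the operator norm, so topological notions for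
  subsets of this type refer to the operator norm topology.\<close>

definition GL :: "('a::real_normed_vector \<Rightarrow>\<^sub>L 'a) set" where
  "GL = {T. \<exists>S. S o\<^sub>L T = id_blinfun \<and> T o\<^sub>L S = id_blinfun}"

end

theory Submission
  imports Defs "Jordan_Normal_Form.Determinant"
begin

text \<open>For invertible \<open>T\<close> whose pencil \<open>T - l\<close> is Fredholm along \<open>[- M, 0]\<close>, the number of negative real
  eigenvalues of \<open>T\<close> modulo 2 is the monodromy of the determinant orientation bundle along the pencil, a homotopy
  invariant as long as the pencil stays Fredholm; it is \<open>1\<close> for the identity and \<open>- 1\<close> for a reflection.
  In an HI space at most one real \<open>l\<close> makes \<open>T - l\<close> non-Fredholm. When that \<open>l\<close> is negative, the
  parity along \<open>[0, M]\<close> replaces the one along \<open>[- M, 0]\<close>. The two differ by the parity along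
  \<open>[- M, M]\<close>, which takes the same value for all \<open>T\<close> whose pencil is Fredholm on the whole real line:
  by the HI property, for two such operators \<open>S\<close>, \<open>T\<close> either the segment from \<open>S\<close> to \<open>T\<close> or
  the one from \<open>S\<close> to \<open>- T\<close> keeps this property, and \<open>T\<close>, \<open>- T\<close> have the same parity.

  Orientations and parities are computed relative to a finite-codimensional closed subspace on which all
  operators in question are bounded below, so that only determinants on the finite-dimensional quotient occur.\<close>

section \<open>Norming functionals\<close>

text \<open>Invertibility along the path keeps 0 out of the exceptional values, and a bound on all
  norms makes the pencils invertible at \<open>M\<close> and \<open>- M\<close>, so every interval
  in play has invertible ends. The path may switch between the two half-lines many times, at
  operators that need not be joined through operators whose pencil is Fredholm everywhere. The
  switching factor has to be the same at all of them; local invariance of parity does not give this,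
  and this is what the comparison of \<open>S\<close> with both \<open>T\<close> and
  \<open>- T\<close> is for. Fredholmness enters only as a lower bound on a finite-codimensional
  subspace; index 0 is inherited by connectedness from an invertible operator. Parities formally
  depend on the chosen frame, so each comparison is stated for all sufficiently fine frames.
  Finitely many comparisons then share one frame, and in it the values at the identity and at the
  reflection are explicit.\<close>

definition sublinear :: "('a::real_normed_vector \<Rightarrow> real) \<Rightarrow> bool" where
  "sublinear p \<longleftrightarrow> (\<forall>x y. p (x + y) \<le> p x + p y) \<and> (\<forall>t x. 0 \<le> t \<longrightarrow> p (t *\<^sub>R x) = t * p x)"

lemma sublinear_zero: "sublinear p \<Longrightarrow> p 0 = 0"
  unfolding sublinear_def by (metis mult_zero_left order_refl scaleR_zero_left)

lemma sublinear_norm: "sublinear norm"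
  unfolding sublinear_def by (simp add: norm_triangle_ineq)

lemma sublinear_minus: "sublinear p \<Longrightarrow> - p (- y) \<le> p y"
  using sublinear_zero[of p] unfolding sublinear_def by (metis add.right_inverse minus_le_iff diff_ge_0_iff_ge diff_minus_eq_add)

text \<open>Taking the infimum of \<open>p (y + t *\<^sub>R x) - t * p x\<close> over t \<ge> 0
  lowers \<open>p\<close> as far as the direction \<open>x\<close> permits: t = 0 gives
  \<open>q y \<le> p y\<close>, and t = 1 at \<open>- x\<close> gives \<open>- p x\<close>.\<close>

lemma sublinear_shift:
  fixes p :: "'a::real_normed_vector \<Rightarrow> real"
  assumes p: "sublinear p"
  obtains q where "sublinear q" "\<And>y. q y \<le> p y" "q (- x) \<le> - p x"
proof -
  have sub: "\<And>x y. p (x + y) \<le> p x + p y" and hom: "\<And>t x. 0 \<le> t \<Longrightarrow> p (t *\<^sub>R x) = t * p x"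
    using p by (auto simp: sublinear_def)
  define r where "r = (\<lambda>y t. p (y + t *\<^sub>R x) - t * p x)"
  define q where "q = (\<lambda>y. INF t\<in>{0..}. r y t)"
  have lb: "- p (- y) \<le> r y t" if "0 \<le> t" for y t
  proof -
    have "t * p x = p ((y + t *\<^sub>R x) + (- y))" using hom[OF that, of x] by simp
    also have "\<dots> \<le> p (y + t *\<^sub>R x) + p (- y)" by (rule sub)
    finally show ?thesis by (simp add: r_def)
  qed
  then have bdd: "bdd_below (r y ` {0..})" for y
    by (intro bdd_belowI2[where m = "- p (- y)"]) auto
  have q_le: "q y \<le> r y t" if "0 \<le> t" for y t
    unfolding q_def by (rule cINF_lower[OF bdd]) (use that in auto)
  have q_ge: "c \<le> q y" if "\<And>t. 0 \<le> t \<Longrightarrow> c \<le> r y t" for c y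
    unfolding q_def by (rule cINF_greatest) (use that in auto)
  have q_sub: "q (y + z) \<le> q y + q z" for y z
  proof -
    have 1: "q (y + z) \<le> r y s + r z t" if "0 \<le> s" "0 \<le> t" for s t
    proof -
      have "q (y + z) \<le> r (y + z) (s + t)" using q_le that by simp
      also have "\<dots> = p ((y + s *\<^sub>R x) + (z + t *\<^sub>R x)) - s * p x - t * p x"
        by (simp add: r_def algebra_simps)
      also have "\<dots> \<le> r y s + r z t" using sub[of "y + s *\<^sub>R x" "z + t *\<^sub>R x"] by (simp add: r_def)
      finally show ?thesis .
    qed
    have "q (y + z) - r z t \<le> q y" if "0 \<le> t" for t
      using 1 that by (intro q_ge) (simp add: algebra_simps)
    then have "q (y + z) - q y \<le> q z"
      by (intro q_ge) (simp add: algebra_simps)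
    then show ?thesis by simp
  qed
  have q_hom1: "q (c *\<^sub>R y) \<le> c * q y" if "0 < c" for c y
  proof -
    have "q (c *\<^sub>R y) / c \<le> r y t" if t: "0 \<le> t" for t
    proof -
      have "q (c *\<^sub>R y) \<le> r (c *\<^sub>R y) (c * t)" using q_le t \<open>0 < c\<close> by simp
      also have "\<dots> = p (c *\<^sub>R (y + t *\<^sub>R x)) - c * t * p x" by (simp add: r_def algebra_simps)
      also have "\<dots> = c * r y t" using hom[of c "y + t *\<^sub>R x"] \<open>0 < c\<close> by (simp add: r_def algebra_simps)
      finally show ?thesis using \<open>0 < c\<close> by (simp add: field_simps)
    qed
    then have "q (c *\<^sub>R y) / c \<le> q y" by (rule q_ge)
    then show ?thesis using \<open>0 < c\<close> by (simp add: field_simps)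
  qed
  have q_zero: "q 0 = 0"
    unfolding q_def r_def using hom[of _ x] by simp
  have q_hom: "q (c *\<^sub>R y) = c * q y" if "0 \<le> c" for c y
  proof (cases "c = 0")
    case False
    with that have "0 < c" by simp
    then have "q y \<le> (1 / c) * q (c *\<^sub>R y)" using q_hom1[of "1 / c" "c *\<^sub>R y"] by simp
    then have "c * q y \<le> q (c *\<^sub>R y)" using \<open>0 < c\<close> by (simp add: field_simps)
    then show ?thesis using q_hom1[OF \<open>0 < c\<close>] by (simp add: antisym)
  qed (use q_zero in simp)
  show thesis
  proof
    show "sublinear q" using q_sub q_hom by (simp add: sublinear_def)
    show "q y \<le> p y" for y using q_le[of 0 y] by (simp add: r_def)
    show "q (- x) \<le> - p x" using q_le[of 1 "- x"] sublinear_zero[OF p] by (simp add: r_def)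
  qed
qed

text \<open>Zorn's lemma in the reversed pointwise order. The infimum of a chain is finite because
  every member is bounded below by \<open>- p (- y)\<close>, and subadditive because of any two
  members the smaller one can be used for both summands.\<close>

lemma minimal_sublinear:
  fixes p :: "'a::real_normed_vector \<Rightarrow> real"
  assumes p: "sublinear p"
  obtains q where "sublinear q" "\<And>y. q y \<le> p y" "\<And>r. sublinear r \<Longrightarrow> (\<And>y. r y \<le> q y) \<Longrightarrow> r = q"
proof -
  define A where "A = {q. sublinear q \<and> (\<forall>y. q y \<le> p y)}"
  \<comment> \<open>\<open>P q r\<close> says that \<open>r\<close> lies below \<open>q\<close>, so
    Zorn's upper bounds are infima and its maximal elements are minimal functionals.\<close>
  define P where "P = (\<lambda>(q::'a \<Rightarrow> real) r. \<forall>y. r y \<le> q y)"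
  have po: "partial_order_on A (relation_of P A)"
    by (intro partial_order_on_relation_ofI) (auto simp: P_def fun_eq_iff intro: order_trans antisym)
  have "\<exists>u\<in>A. \<forall>a\<in>C. P a u" if C: "C \<in> Chains (relation_of P A)" for C
  proof (cases "C = {}")
    case True
    then show ?thesis using p by (auto simp: A_def)
  next
    case False
    have CA: "C \<subseteq> A" and tot: "\<And>a b. a \<in> C \<Longrightarrow> b \<in> C \<Longrightarrow> P a b \<or> P b a"
      using C by (auto simp: Chains_def relation_of_def)
    define u where "u = (\<lambda>y. INF q\<in>C. q y)"
    have bdd: "bdd_below ((\<lambda>q. q y) ` C)" for y
    proof (rule bdd_belowI2)
      fix q assume "q \<in> C"
      then have "q \<in> A" using CA by auto
      then have "- q (- y) \<le> q y" "q (- y) \<le> p (- y)" using sublinear_minus by (auto simp: A_def)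
      then show "- p (- y) \<le> q y" by linarith
    qed
    have u_le: "u y \<le> q y" if "q \<in> C" for q y
      unfolding u_def by (rule cINF_lower[OF bdd that])
    have u_ge: "c \<le> u y" if "\<And>q. q \<in> C \<Longrightarrow> c \<le> q y" for c y
      unfolding u_def by (rule cINF_greatest[OF False]) (use that in auto)
    have "u (x + y) \<le> u x + u y" for x y
    proof -
      have 1: "u (x + y) \<le> q x + r y" if qr: "q \<in> C" "r \<in> C" for q r
      proof -
        have *: "u (x + y) \<le> s x + s y" if "s \<in> C" for s
          using u_le[OF that, of "x + y"] that CA unfolding A_def sublinear_def by (blast intro: order_trans)
        from tot[OF qr] show ?thesis
        proof
          assume "P q r"
          then show ?thesis using *[OF qr(2)] unfolding P_def by (smt (verit))
        next
          assume "P r q"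
          then show ?thesis using *[OF qr(1)] unfolding P_def by (smt (verit))
        qed
      qed
      have "u (x + y) - r y \<le> u x" if "r \<in> C" for r
        using 1 that by (intro u_ge) (simp add: algebra_simps)
      then have "u (x + y) - u x \<le> u y" by (intro u_ge) (simp add: algebra_simps)
      then show ?thesis by simp
    qed
    moreover have "u (t *\<^sub>R x) = t * u x" if t: "0 \<le> t" for t x
    proof -
      have "(\<lambda>q. q (t *\<^sub>R x)) ` C = (\<lambda>q. t * q x) ` C"
        using CA t by (intro image_cong) (auto simp: A_def sublinear_def)
      then have eq: "u (t *\<^sub>R x) = (INF q\<in>C. t * q x)" by (simp add: u_def)
      show ?thesis
      proof (cases "t = 0")
        case True
        then show ?thesis using False unfolding eq by simp
      next
        case False
        then have "0 < t" using t by simp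
        have le: "t * u x \<le> u (t *\<^sub>R x)" unfolding eq
          by (rule cINF_greatest[OF \<open>C \<noteq> {}\<close>]) (use u_le t mult_left_mono in blast)
        have "u (t *\<^sub>R x) / t \<le> u x"
        proof (rule u_ge)
          fix q assume q: "q \<in> C"
          then have "q (t *\<^sub>R x) = t * q x" using CA t by (auto simp: A_def sublinear_def)
          then show "u (t *\<^sub>R x) / t \<le> q x" using u_le[OF q, of "t *\<^sub>R x"] \<open>0 < t\<close>
            by (simp add: field_simps)
        qed
        then show ?thesis using le \<open>0 < t\<close> by (simp add: field_simps)
      qed
    qed
    moreover have "u y \<le> p y" for y
    proof -
      obtain q where "q \<in> C" using False by auto
      then show ?thesis using u_le[of q y] CA by (auto simp: A_def intro: order_trans)
    qed
    ultimately have "u \<in> A" by (simp add: A_def sublinear_def)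
    then show ?thesis using u_le by (auto simp: P_def)
  qed
  from predicate_Zorn[OF po this] obtain q where q: "q \<in> A" "\<forall>a\<in>A. P q a \<longrightarrow> a = q" by auto
  show thesis
  proof
    show "sublinear q" "q y \<le> p y" for y using q by (auto simp: A_def)
    show "r = q" if "sublinear r" "\<And>y. r y \<le> q y" for r
    proof -
      have "r \<in> A" using that q(1) by (auto simp: A_def intro: order_trans)
      then show ?thesis using q(2) that by (auto simp: P_def)
    qed
  qed
qed

text \<open>Hahn-Banach via minimal sublinear functionals: minimality under the shift of
  \<open>sublinear_shift\<close> forces \<open>q (- x) = - q x\<close>, hence linearity.\<close>

lemma norming_functional:
  fixes x :: "'a::real_normed_vector"
  obtains g :: "'a \<Rightarrow>\<^sub>L real" where "norm g \<le> 1" "blinfun_apply g x = norm x"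
proof -
  \<comment> \<open>This first shift pins the value at \<open>x\<close>: every functional below
    \<open>p\<close> is at most \<open>- norm x\<close> at \<open>- x\<close>, hence at least
    \<open>norm x\<close> at \<open>x\<close> once it is odd.\<close>
  obtain p where p: "sublinear p" "\<And>y. p y \<le> norm y" "p (- x) \<le> - norm x"
    using sublinear_shift[OF sublinear_norm, of x] by metis
  obtain q where q: "sublinear q" "\<And>y. q y \<le> p y"
    and min: "\<And>r. sublinear r \<Longrightarrow> (\<And>y. r y \<le> q y) \<Longrightarrow> r = q"
    using minimal_sublinear[OF p(1)] by blast
  have neg: "q (- y) = - q y" for y
  proof -
    obtain r where r: "sublinear r" "\<And>z. r z \<le> q z" "r (- y) \<le> - q y"
      using sublinear_shift[OF q(1), of y] by metis
    then have "q (- y) \<le> - q y" using min[of r] by auto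
    then show ?thesis using sublinear_minus[OF q(1), of "y"] by linarith
  qed
  have sub: "\<And>x y. q (x + y) \<le> q x + q y" and hom: "\<And>t x. 0 \<le> t \<Longrightarrow> q (t *\<^sub>R x) = t * q x"
    using q by (auto simp: sublinear_def)
  have add: "q (y + z) = q y + q z" for y z
    using sub[of y z] sub[of "- y" "- z"] neg[of y] neg[of z] neg[of "y + z"] by simp
  have scale: "q (t *\<^sub>R y) = t * q y" for t y
    using hom[of t y] hom[of "- t" y] neg[of "t *\<^sub>R y"] by (cases "0 \<le> t") auto
  have le: "q y \<le> norm y" for y using q(2) p(2) order_trans by blast
  have bound: "\<bar>q y\<bar> \<le> norm y" for y using le[of y] le[of "- y"] neg[of y] by simp
  have bl: "bounded_linear q"
    by (rule bounded_linear_intro[where K = 1]) (use add scale bound in auto)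
  show thesis
  proof
    have ap: "blinfun_apply (Blinfun q) = q" using bl by (rule bounded_linear_Blinfun_apply)
    show "norm (Blinfun q) \<le> 1" by (rule norm_blinfun_bound) (use bound ap in auto)
    have "q (- x) \<le> - norm x" using q(2)[of "- x"] p(3) by simp
    then show "blinfun_apply (Blinfun q) x = norm x" using neg[of x] le[of x] ap by simp
  qed
qed

section \<open>Semi-Fredholm operators on HI spaces\<close>

definition ann :: "('a::real_normed_vector \<Rightarrow>\<^sub>L real) set \<Rightarrow> 'a set" where
  "ann F = {x. \<forall>g\<in>F. blinfun_apply g x = 0}"

text \<open>On a Banach space these are the upper semi-Fredholm operators (finite-dimensional
  kernel, closed range). In this form stability under small perturbations is immediate.\<close>

definition upper_fredholm :: "('a::real_normed_vector \<Rightarrow>\<^sub>L 'a) \<Rightarrow> bool" where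
  "upper_fredholm L \<longleftrightarrow>
     (\<exists>F c. finite F \<and> 0 < c \<and> (\<forall>x\<in>ann F. c * norm x \<le> norm (blinfun_apply L x)))"

lemma ann_Un: "ann (F \<union> G) = ann F \<inter> ann G"
  by (auto simp: ann_def)

lemma subspace_ann: "subspace (ann F)"
  by (auto simp: ann_def subspace_def blinfun.bilinear_simps)

lemma closed_ann: "closed (ann F)"
proof -
  have "ann F = (\<Inter>g\<in>F. {x. blinfun_apply g x = 0})" by (auto simp: ann_def)
  then show ?thesis by (auto intro!: closed_INT closed_Collect_eq continuous_intros)
qed

lemma not_upper_fredholm_vector:
  assumes "\<not> upper_fredholm L" "finite F" "0 < \<epsilon>"
  obtains x where "x \<in> ann F" "norm x = 1" "norm (blinfun_apply L x) < \<epsilon>"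
proof -
  obtain x where x: "x \<in> ann F" "norm (blinfun_apply L x) < \<epsilon> * norm x"
    using assms unfolding upper_fredholm_def by (metis not_le)
  then have "x \<noteq> 0" by auto
  show thesis
  proof
    show "(1 / norm x) *\<^sub>R x \<in> ann F" using x(1) subspace_ann subspace_scale by blast
    show "norm ((1 / norm x) *\<^sub>R x) = 1" using \<open>x \<noteq> 0\<close> by simp
    show "norm (blinfun_apply L ((1 / norm x) *\<^sub>R x)) < \<epsilon>"
      using x(2) \<open>x \<noteq> 0\<close> by (simp add: blinfun.bilinear_simps field_simps)
  qed
qed

text \<open>Applying \<open>g k\<close> kills all later vectors, which bounds the k-th coefficient
  by \<open>norm y\<close> plus the sum of the earlier ones; this recursion has the solution
  \<open>2 ^ k\<close>. The growth is harmless since the vectors will be chosen with images decaying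
  like \<open>(1/4) ^ k\<close>.\<close>

lemma triangular_coefficient_bound:
  fixes x :: "nat \<Rightarrow> 'a::real_normed_vector" and g :: "nat \<Rightarrow> 'a \<Rightarrow>\<^sub>L real"
  assumes g1: "\<And>k. norm (g k) \<le> 1" and gx: "\<And>k. blinfun_apply (g k) (x k) = 1"
    and g0: "\<And>j k. k < j \<Longrightarrow> blinfun_apply (g k) (x j) = 0"
    and x1: "\<And>k. norm (x k) \<le> 1" and "k < N"
  shows "\<bar>a k\<bar> \<le> 2 ^ k * norm (\<Sum>j<N. a j *\<^sub>R x j)"
  using \<open>k < N\<close>
proof (induction k rule: less_induct)
  case (less k)
  define y where "y = (\<Sum>j<N. a j *\<^sub>R x j)"
  have gle: "\<bar>blinfun_apply (g k) z\<bar> \<le> norm z" for z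
    using norm_blinfun[of "g k" z] mult_right_mono[OF g1[of k], of "norm z"] by simp
  have "blinfun_apply (g k) y = (\<Sum>j<N. a j * blinfun_apply (g k) (x j))"
    by (simp add: y_def blinfun.bilinear_simps blinfun.sum_right)
  also have "\<dots> = (\<Sum>j<Suc k. a j * blinfun_apply (g k) (x j))"
    by (rule sum.mono_neutral_right) (use less.prems g0 in \<open>auto simp: not_less_eq\<close>)
  finally have "a k = blinfun_apply (g k) y - (\<Sum>j<k. a j * blinfun_apply (g k) (x j))"
    by (simp add: gx)
  then have "\<bar>a k\<bar> \<le> \<bar>blinfun_apply (g k) y\<bar> + \<bar>\<Sum>j<k. a j * blinfun_apply (g k) (x j)\<bar>"
    by simp
  also have "\<dots> \<le> norm y + (\<Sum>j<k. \<bar>a j\<bar> * 1)"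
  proof (rule add_mono[OF gle order_trans[OF sum_abs sum_mono]])
    show "\<bar>a j * blinfun_apply (g k) (x j)\<bar> \<le> \<bar>a j\<bar> * 1" for j
      using gle[of "x j"] x1[of j] by (simp add: abs_mult mult_left_le)
  qed
  also have "\<dots> \<le> norm y + (\<Sum>j<k. 2 ^ j * norm y)"
    using less by (intro add_left_mono sum_mono) (auto simp: y_def)
  also have "\<dots> = (1 + (\<Sum>j<k. 2 ^ j)) * norm y" by (simp only: sum_distrib_right distrib_right mult_1_left)
  also have "1 + (\<Sum>j<k. 2 ^ j :: real) = 2 ^ k" by (induction k) auto
  finally show ?case by (simp add: y_def)
qed

lemma span_range_nat:
  fixes x :: "nat \<Rightarrow> 'a::real_vector"
  assumes "y \<in> span (range x)"
  obtains a N where "y = (\<Sum>j<N. a j *\<^sub>R x j)"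
proof -
  have "\<exists>N a. y = (\<Sum>j<N. a j *\<^sub>R x j)"
    using assms
  proof (induction rule: span_induct_alt)
    case base
    show ?case by (rule exI[where x = 0]) simp
  next
    case (step c z y)
    then obtain k N a where z: "z = x k" and y: "y = (\<Sum>j<N. a j *\<^sub>R x j)" by auto
    define M where "M = max N (Suc k)"
    have "y = (\<Sum>j<M. (if j < N then a j else 0) *\<^sub>R x j)"
      unfolding y by (rule sum.mono_neutral_cong_left) (auto simp: M_def)
    moreover have "c *\<^sub>R z = (\<Sum>j<M. (if j = k then c else 0) *\<^sub>R x j)"
    proof -
      have "(\<Sum>j<M. (if j = k then c else 0) *\<^sub>R x j) = (\<Sum>j\<in>{k}. (if j = k then c else 0) *\<^sub>R x j)"
        by (rule sum.mono_neutral_right) (auto simp: M_def)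
      then show ?thesis by (simp add: z)
    qed
    ultimately have "c *\<^sub>R z + y =
        (\<Sum>j<M. ((if j = k then c else 0) + (if j < N then a j else 0)) *\<^sub>R x j)"
      by (simp add: scaleR_add_left sum.distrib)
    then show ?case by (intro exI[where x = M] exI) assumption
  qed
  then show thesis using that by blast
qed

lemma infinite_dimensional_if_independent:
  fixes x :: "nat \<Rightarrow> 'a::real_vector"
  assumes indep: "\<And>a N k. (\<Sum>j<N. a j *\<^sub>R x j) = 0 \<Longrightarrow> k < N \<Longrightarrow> a k = 0" and "range x \<subseteq> Y"
  shows "infinite_dimensional Y"
  unfolding infinite_dimensional_def
proof
  assume "\<exists>B. finite B \<and> Y \<subseteq> span B"
  then obtain B where B: "finite B" "Y \<subseteq> span B" by auto
  define N where "N = Suc (card B)"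
  have inj: "inj_on x {..<N}"
  proof (rule inj_onI, rule ccontr)
    fix i j assume ij: "i \<in> {..<N}" "j \<in> {..<N}" "x i = x j" "i \<noteq> j"
    define a where "a k = (if k = i then 1 else if k = j then - 1 else (0::real))" for k
    have "(\<Sum>k<N. a k *\<^sub>R x k) = (\<Sum>k\<in>{i,j}. a k *\<^sub>R x k)"
      by (rule sum.mono_neutral_right) (use ij in \<open>auto simp: a_def\<close>)
    also have "\<dots> = 0" using ij by (simp add: a_def)
    finally have "a i = 0" using indep ij by blast
    then show False by (simp add: a_def)
  qed
  have "independent (x ` {..<N})"
  proof (rule independent_if_scalars_zero)
    fix f v assume z: "(\<Sum>v\<in>x ` {..<N}. f v *\<^sub>R v) = 0" and "v \<in> x ` {..<N}"
    then obtain k where k: "k < N" "v = x k" by auto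
    have "(\<Sum>j<N. f (x j) *\<^sub>R x j) = 0" using z by (simp add: sum.reindex[OF inj])
    from indep[OF this k(1)] show "f v = 0" using k by simp
  qed simp
  then have "card (x ` {..<N}) \<le> card B"
    using independent_span_bound[OF B(1)] B(2) \<open>range x \<subseteq> Y\<close> by blast
  then show False using card_image[OF inj] by (simp add: N_def)
qed

lemma subspace_closure:
  fixes S :: "'a::real_normed_vector set"
  assumes S: "subspace S"
  shows "subspace (closure S)"
  unfolding subspace_def
proof (intro conjI ballI allI)
  show "0 \<in> closure S" using subspace_0[OF S] closure_subset by blast
next
  fix x y assume "x \<in> closure S" "y \<in> closure S"
  then obtain u v where u: "\<And>n. u n \<in> S" "u \<longlonglongrightarrow> x" and v: "\<And>n. v n \<in> S" "v \<longlonglongrightarrow> y"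
    unfolding closure_sequential by blast
  have "(\<lambda>n. u n + v n) \<longlonglongrightarrow> x + y" by (rule tendsto_add[OF u(2) v(2)])
  moreover have "u n + v n \<in> S" for n using S u(1) v(1) by (rule subspace_add)
  ultimately show "x + y \<in> closure S"
    unfolding closure_sequential by (intro exI[where x = "\<lambda>n. u n + v n"]) auto
next
  fix c x assume "x \<in> closure S"
  then obtain u where u: "\<And>n. u n \<in> S" "u \<longlonglongrightarrow> x" unfolding closure_sequential by blast
  have "(\<lambda>n. c *\<^sub>R u n) \<longlonglongrightarrow> c *\<^sub>R x" by (rule tendsto_scaleR[OF tendsto_const u(2)])
  moreover have "c *\<^sub>R u n \<in> S" for n using S u(1) by (rule subspace_scale)
  ultimately show "c *\<^sub>R x \<in> closure S"
    unfolding closure_sequential by (intro exI[where x = "\<lambda>n. c *\<^sub>R u n"]) auto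
qed

text \<open>Unit vectors with rapidly decreasing images are chosen one after another, each
  annihilated by norming functionals of all previous ones. Coefficients then grow at most like
  \<open>2 ^ k\<close> while images decay like \<open>(1/4) ^ Suc k\<close>, so the smallness of
  \<open>L\<close> on the chosen vectors survives on their closed span.\<close>

lemma small_subspace:
  fixes L :: "'a::real_normed_vector \<Rightarrow>\<^sub>L 'a"
  assumes L: "\<not> upper_fredholm L" and F: "finite F" and "0 < \<epsilon>"
  obtains Y where "banach_subspace Y" "Y \<subseteq> ann F" "\<And>y. y \<in> Y \<Longrightarrow> norm (blinfun_apply L y) \<le> \<epsilon> * norm y"
proof -
  \<comment> \<open>A state is the set \<open>G\<close> of functionals imposed so far, the current
    vector and its norming functional, already put into \<open>G\<close>. The relation
    \<open>Q\<close> places the next vector in \<open>ann G\<close>, which produces the triangular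
    system.\<close>
  define P where "P = (\<lambda>k (G, x, g :: 'a \<Rightarrow>\<^sub>L real). finite G \<and> F \<subseteq> G \<and> g \<in> G \<and> x \<in> ann F \<and> norm x = 1 \<and>
     norm (blinfun_apply L x) \<le> \<epsilon> * (1/4) ^ Suc k \<and> norm g \<le> 1 \<and> blinfun_apply g x = 1)"
  define Q where "Q = (\<lambda>(k::nat) (G :: ('a \<Rightarrow>\<^sub>L real) set, x :: 'a, g :: 'a \<Rightarrow>\<^sub>L real) (G', x', g' :: 'a \<Rightarrow>\<^sub>L real). G \<subseteq> G' \<and> x' \<in> ann G)"
  have next_ex: "\<exists>x (g :: 'a \<Rightarrow>\<^sub>L real). x \<in> ann G \<and> norm x = 1 \<and> norm (blinfun_apply L x) \<le> \<epsilon> * (1/4) ^ Suc k \<and>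
       norm g \<le> 1 \<and> blinfun_apply g x = 1" if G: "finite G" for G k
  proof -
    have "0 < \<epsilon> * (1/4) ^ Suc k" using \<open>0 < \<epsilon>\<close> by simp
    then obtain x where x: "x \<in> ann G" "norm x = 1" "norm (blinfun_apply L x) < \<epsilon> * (1/4) ^ Suc k"
      using not_upper_fredholm_vector[OF L G] by blast
    obtain g :: "'a \<Rightarrow>\<^sub>L real" where "norm g \<le> 1" "blinfun_apply g x = norm x"
      using norming_functional by blast
    then show ?thesis using x by (intro exI[where x = x] exI[where x = g]) auto
  qed
  have "\<exists>s. \<forall>k. P k (s k) \<and> Q k (s k) (s (Suc k))"
  proof (rule dependent_nat_choice)
    obtain x and g :: "'a \<Rightarrow>\<^sub>L real" where "x \<in> ann F" "norm x = 1" "norm (blinfun_apply L x) \<le> \<epsilon> * (1/4) ^ Suc 0"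
       "norm g \<le> 1" "blinfun_apply g x = 1" using next_ex[OF F, of 0] by blast
    then show "\<exists>s. P 0 s" using F by (intro exI[where x = "(insert g F, x, g)"]) (auto simp: P_def)
  next
    fix s k assume "P k s"
    obtain G x g where s: "s = (G, x, g)" by (cases s)
    have G: "finite G" "F \<subseteq> G" using \<open>P k s\<close> by (auto simp: P_def s)
    obtain x' and g' :: "'a \<Rightarrow>\<^sub>L real" where n: "x' \<in> ann G" "norm x' = 1" "norm (blinfun_apply L x') \<le> \<epsilon> * (1/4) ^ Suc (Suc k)"
       "norm g' \<le> 1" "blinfun_apply g' x' = 1" using next_ex[OF G(1), of "Suc k"] by blast
    moreover have "x' \<in> ann F" using n(1) G by (auto simp: ann_def)
    ultimately show "\<exists>s'. P (Suc k) s' \<and> Q k s s'"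
      using G by (intro exI[where x = "(insert g' G, x', g')"]) (auto simp: P_def Q_def s)
  qed
  then obtain s where s: "\<And>k. P k (s k)" "\<And>k. Q k (s k) (s (Suc k))" by blast
  define G where "G k = fst (s k)" for k
  define x where "x k = fst (snd (s k))" for k
  define g where "g k = snd (snd (s k))" for k
  have sk: "s k = (G k, x k, g k)" for k by (simp add: G_def x_def g_def)
  have G: "G k \<subseteq> G (Suc k)" and xG: "x (Suc k) \<in> ann (G k)" for k
    using s(2)[of k] by (auto simp: Q_def sk)
  have gG: "g k \<in> G k" and xF: "x k \<in> ann F" and x1: "norm (x k) = 1"
    and Lx: "norm (blinfun_apply L (x k)) \<le> \<epsilon> * (1/4) ^ Suc k" and g1: "norm (g k) \<le> 1"
    and gx: "blinfun_apply (g k) (x k) = 1" for k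
    using s(1)[of k] by (auto simp: P_def sk)
  have "G k \<subseteq> G j" if "k \<le> j" for k j using lift_Suc_mono_le[of G, OF G that] .
  then have g0: "blinfun_apply (g k) (x j) = 0" if "k < j" for k j
    using that xG[of "j - 1"] gG[of k] by (cases j) (auto simp: ann_def less_Suc_eq_le)
  have coeff: "\<bar>a k\<bar> \<le> 2 ^ k * norm (\<Sum>j<N. a j *\<^sub>R x j)" if "k < N" for a k N
    by (rule triangular_coefficient_bound[OF g1 gx g0 _ that]) (simp_all add: x1)
  define Y where "Y = closure (span (range x))"
  show thesis
  proof
    have "range x \<subseteq> Y" unfolding Y_def by (rule order_trans[OF span_superset closure_subset])
    moreover have "a k = 0" if "(\<Sum>j<N. a j *\<^sub>R x j) = 0" "k < N" for a N k
      using coeff[OF that(2), of a] that(1) by simp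
    ultimately have "infinite_dimensional Y" by (rule infinite_dimensional_if_independent[rotated])
    then show "banach_subspace Y" by (simp add: banach_subspace_def Y_def subspace_closure)
    have "span (range x) \<subseteq> ann F" using xF subspace_ann by (intro span_minimal) auto
    then show "Y \<subseteq> ann F" unfolding Y_def by (rule closure_minimal[OF _ closed_ann])
    have span_le: "norm (blinfun_apply L y) \<le> \<epsilon> * norm y" if "y \<in> span (range x)" for y
    proof -
      obtain a N where y: "y = (\<Sum>j<N. a j *\<^sub>R x j)" using span_range_nat[OF \<open>y \<in> _\<close>] by blast
      have "norm (blinfun_apply L y) \<le> (\<Sum>j<N. norm (a j *\<^sub>R blinfun_apply L (x j)))"
        unfolding y blinfun.sum_right blinfun.scaleR_right by (rule norm_sum)
      also have "\<dots> \<le> (\<Sum>j<N. (2 ^ j * norm y) * (\<epsilon> * (1/4) ^ Suc j))"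
      proof (rule sum_mono)
        fix j assume "j \<in> {..<N}"
        then have "\<bar>a j\<bar> \<le> 2 ^ j * norm y" using coeff[of j N a] by (simp add: y)
        then show "norm (a j *\<^sub>R blinfun_apply L (x j)) \<le> (2 ^ j * norm y) * (\<epsilon> * (1/4) ^ Suc j)"
          unfolding norm_scaleR using Lx by (intro mult_mono) auto
      qed
      also have "\<dots> = (\<Sum>j<N. \<epsilon> * norm y / 4 * (1/2) ^ j)"
      proof (rule sum.cong[OF refl])
        fix j
        have "(2::real) ^ j * (1/4) ^ j = (1/2) ^ j" by (simp flip: power_mult_distrib)
        then have "\<epsilon> * norm y / 4 * (2 ^ j * (1/4) ^ j) = \<epsilon> * norm y / 4 * (1/2) ^ j" by (rule arg_cong)
        then show "(2 ^ j * norm y) * (\<epsilon> * (1/4) ^ Suc j) = \<epsilon> * norm y / 4 * (1/2) ^ j"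
          unfolding power_Suc by (simp only: mult_ac times_divide_eq_left times_divide_eq_right mult_1)
      qed
      also have "\<dots> = \<epsilon> * norm y / 4 * (\<Sum>j<N. (1/2) ^ j)" by (simp add: sum_distrib_left)
      \<comment> \<open>The geometric series stays below 2, leaving even half of the permitted
        bound.\<close>
      also have "\<dots> \<le> \<epsilon> * norm y / 4 * 2"
      proof (rule mult_left_mono)
        have "(\<Sum>j<N. (1/2::real) ^ j) = 2 - 2 * (1/2) ^ N" by (induction N) auto
        also have "\<dots> \<le> 2" by simp
        finally show "(\<Sum>j<N. (1/2::real) ^ j) \<le> 2" .
      qed (use \<open>0 < \<epsilon>\<close> in simp)
      also have "\<dots> \<le> \<epsilon> * norm y" using \<open>0 < \<epsilon>\<close> by simp
      finally show ?thesis .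
    qed
    have "closed {y. norm (blinfun_apply L y) \<le> \<epsilon> * norm y}"
      by (intro closed_Collect_le continuous_intros)
    then have "Y \<subseteq> {y. norm (blinfun_apply L y) \<le> \<epsilon> * norm y}"
      unfolding Y_def by (rule closure_minimal[rotated]) (use span_le in auto)
    then show "\<And>y. y \<in> Y \<Longrightarrow> norm (blinfun_apply L y) \<le> \<epsilon> * norm y" by auto
  qed
qed

section \<open>Common approximate null vectors in HI spaces\<close>

text \<open>If unit vectors of \<open>Y\<close> stayed at a positive distance from \<open>Z\<close>,
  the sum would be direct, and closed as well: the gap makes the \<open>Y\<close>-components of a
  convergent sequence of sums Cauchy. This is what an HI space forbids.\<close>

lemma HI_close_vectors:
  fixes Y Z :: "'a::banach set"
  assumes HI: "hereditarily_indecomposable TYPE('a)" and Y: "banach_subspace Y" and Z: "banach_subspace Z"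
    and "0 < \<epsilon>"
  obtains y z where "y \<in> Y" "z \<in> Z" "norm y = 1" "norm (y - z) < \<epsilon>"
proof -
  have sY: "subspace Y" "closed Y" and sZ: "subspace Z" "closed Z"
    using Y Z by (auto simp: banach_subspace_def)
  have "\<exists>y\<in>Y. \<exists>z\<in>Z. norm (y - z) < \<epsilon> * norm y"
  proof (rule ccontr)
    assume "\<not> ?thesis"
    then have gap: "\<epsilon> * norm y \<le> norm (y - z)" if "y \<in> Y" "z \<in> Z" for y z
      using that by (meson not_le)
    have "Y \<inter> Z = {0}"
    proof -
      have "y = 0" if "y \<in> Y" "y \<in> Z" for y using gap[OF that] \<open>0 < \<epsilon>\<close> by (simp add: mult_le_0_iff)
      then show ?thesis using subspace_0 sY sZ by auto
    qed
    moreover have "closed {y + z | y z. y \<in> Y \<and> z \<in> Z}" (is "closed ?S")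
      unfolding closed_sequential_limits
    proof (intro allI impI, elim conjE)
      fix w l assume w: "\<forall>n. w n \<in> ?S" and l: "w \<longlonglongrightarrow> l"
      then have "\<forall>n. \<exists>y z. w n = y + z \<and> y \<in> Y \<and> z \<in> Z" by blast
      then obtain y z where yz: "\<And>n. w n = y n + z n" "\<And>n. y n \<in> Y" "\<And>n. z n \<in> Z" by metis
      have "Cauchy y"
      proof (rule metric_CauchyI)
        fix e :: real assume "0 < e"
        then obtain M where M: "\<And>m n. m \<ge> M \<Longrightarrow> n \<ge> M \<Longrightarrow> dist (w m) (w n) < e * \<epsilon>"
          using metric_CauchyD[OF LIMSEQ_imp_Cauchy[OF l], of "e * \<epsilon>"] \<open>0 < \<epsilon>\<close> by auto
        have "dist (y m) (y n) < e" if "m \<ge> M" "n \<ge> M" for m n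
        proof -
          have "\<epsilon> * norm (y m - y n) \<le> norm ((y m - y n) - (z n - z m))"
            using gap yz sY sZ by (meson subspace_diff)
          also have "\<dots> = dist (w m) (w n)" by (simp add: yz(1) dist_norm algebra_simps)
          also have "\<dots> < e * \<epsilon>" using M that by simp
          finally show ?thesis using \<open>0 < \<epsilon>\<close> by (simp add: dist_norm mult.commute)
        qed
        then show "\<exists>M. \<forall>m\<ge>M. \<forall>n\<ge>M. dist (y m) (y n) < e" by blast
      qed
      then obtain y' where y': "y \<longlonglongrightarrow> y'" using Cauchy_convergent_iff convergentD by blast
      then have z': "z \<longlonglongrightarrow> l - y'"
        using tendsto_diff[OF l y'] by (simp add: yz(1))
      have "y' \<in> Y" "l - y' \<in> Z"
        using closed_sequentially[OF sY(2) yz(2) y'] closed_sequentially[OF sZ(2) yz(3) z'] .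
      then show "l \<in> ?S" by (intro CollectI exI[where x = y'] exI[where x = "l - y'"]) auto
    qed
    ultimately show False using HI Y Z unfolding hereditarily_indecomposable_def by blast
  qed
  then obtain y z where yz: "y \<in> Y" "z \<in> Z" "norm (y - z) < \<epsilon> * norm y" by blast
  then have "y \<noteq> 0" by auto
  show thesis
  proof
    show "(1 / norm y) *\<^sub>R y \<in> Y" "(1 / norm y) *\<^sub>R z \<in> Z" using yz sY sZ subspace_scale by blast+
    show "norm ((1 / norm y) *\<^sub>R y) = 1" using \<open>y \<noteq> 0\<close> by simp
    show "norm ((1 / norm y) *\<^sub>R y - (1 / norm y) *\<^sub>R z) < \<epsilon>"
    proof -
      have "norm ((1 / norm y) *\<^sub>R y - (1 / norm y) *\<^sub>R z) = norm (y - z) / norm y"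
        unfolding scaleR_diff_right[symmetric] by simp
      then show ?thesis using yz(3) \<open>y \<noteq> 0\<close> by (simp add: divide_less_eq)
    qed
  qed
qed

text \<open>\<open>S\<close> is small on one infinite-dimensional subspace and \<open>T\<close> on
  another; since the two come arbitrarily close, a unit vector of the first is almost in the second.
  Any two failures of Fredholmness in an HI space thus share approximate null vectors.\<close>

lemma HI_common_small_vector:
  fixes S T :: "'a::banach \<Rightarrow>\<^sub>L 'a"
  assumes HI: "hereditarily_indecomposable TYPE('a)"
    and "\<not> upper_fredholm S" "\<not> upper_fredholm T" "finite F" "0 < \<epsilon>"
  obtains x where "x \<in> ann F" "norm x = 1" "norm (blinfun_apply S x) < \<epsilon>" "norm (blinfun_apply T x) < \<epsilon>"
proof -
  \<comment> \<open>The minimum with 1 gives \<open>norm z \<le> 2\<close>; the other bound makes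
    \<open>\<delta> * 2 + norm T * \<delta>\<close>, which dominates the image of \<open>y\<close>
    under \<open>T\<close>, at most half of \<epsilon>.\<close>
  define \<delta> where "\<delta> = min 1 (\<epsilon> / (2 * (2 + norm T)))"
  have \<delta>: "0 < \<delta>" "\<delta> \<le> 1" using \<open>0 < \<epsilon>\<close> by (auto simp: \<delta>_def intro!: divide_pos_pos add_pos_nonneg)
  have "\<delta> \<le> \<epsilon> / (2 * (2 + norm T))" by (simp add: \<delta>_def)
  then have \<delta>': "\<delta> * (2 * (2 + norm T)) \<le> \<epsilon>"
    by (simp add: pos_le_divide_eq add_pos_nonneg)
  obtain Y where Y: "banach_subspace Y" "Y \<subseteq> ann F" "\<And>y. y \<in> Y \<Longrightarrow> norm (blinfun_apply S y) \<le> \<delta> * norm y"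
    using small_subspace[OF \<open>\<not> upper_fredholm S\<close> \<open>finite F\<close> \<delta>(1)] by blast
  obtain Z where Z: "banach_subspace Z" "\<And>z. z \<in> Z \<Longrightarrow> norm (blinfun_apply T z) \<le> \<delta> * norm z"
    using small_subspace[OF \<open>\<not> upper_fredholm T\<close> \<open>finite F\<close> \<delta>(1)] by blast
  obtain y z where yz: "y \<in> Y" "z \<in> Z" "norm y = 1" "norm (y - z) < \<delta>"
    using HI_close_vectors[OF HI Y(1) Z(1) \<delta>(1)] by blast
  show thesis
  proof
    show "y \<in> ann F" "norm y = 1" using yz Y by auto
    have "0 \<le> \<delta> * (norm T * 2)" using \<delta>(1) by simp
    then have "\<delta> * 4 \<le> \<epsilon>" using \<delta>' by (simp add: algebra_simps)
    then show "norm (blinfun_apply S y) < \<epsilon>" using Y(3)[OF yz(1)] yz(3) \<delta> by simp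
    have "norm z \<le> norm y + norm (y - z)" by norm
    then have "norm z \<le> 2" using yz \<delta> by simp
    have "norm (blinfun_apply T y) \<le> norm (blinfun_apply T z) + norm (blinfun_apply T (y - z))"
      by (metis blinfun.add_right diff_add_cancel norm_triangle_ineq add.commute)
    also have "\<dots> \<le> \<delta> * norm z + norm T * norm (y - z)"
      using Z(2)[OF yz(2)] norm_blinfun[of T "y - z"] by simp
    also have "\<dots> \<le> \<delta> * 2 + norm T * \<delta>"
      using \<open>norm z \<le> 2\<close> \<delta> yz(4) by (intro add_mono mult_left_mono) auto
    also have "\<dots> < \<delta> * (2 * (2 + norm T))"
    proof -
      have "\<delta> * (2 * (2 + norm T)) = (\<delta> * 2 + norm T * \<delta>) + (\<delta> * 2 + norm T * \<delta>)" 
        by (simp add: algebra_simps)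
      moreover have "0 < \<delta> * 2 + norm T * \<delta>" using \<delta> by (intro add_pos_nonneg) auto
      ultimately show ?thesis by linarith
    qed
    also have "\<dots> \<le> \<epsilon>" by (rule \<delta>')
    finally show "norm (blinfun_apply T y) < \<epsilon>" .
  qed
qed

section \<open>Invertible operators\<close>

definition binv :: "('a::real_normed_vector \<Rightarrow>\<^sub>L 'a) \<Rightarrow> ('a \<Rightarrow>\<^sub>L 'a)" where
  "binv T = (SOME S. S o\<^sub>L T = id_blinfun \<and> T o\<^sub>L S = id_blinfun)"

lemma binv_props:
  assumes "T \<in> GL"
  shows "binv T o\<^sub>L T = id_blinfun" "T o\<^sub>L binv T = id_blinfun"
  using someI_ex[of "\<lambda>S. S o\<^sub>L T = id_blinfun \<and> T o\<^sub>L S = id_blinfun"] assms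
  by (auto simp: GL_def binv_def)

lemma binv_apply [simp]:
  assumes "T \<in> GL"
  shows "blinfun_apply (binv T) (blinfun_apply T x) = x" "blinfun_apply T (blinfun_apply (binv T) x) = x"
  using binv_props[OF assms] by (metis blinfun_apply_blinfun_compose blinfun_apply_id_blinfun)+

lemma GLI:
  assumes "\<And>x. blinfun_apply S (blinfun_apply T x) = x" "\<And>x. blinfun_apply T (blinfun_apply S x) = x"
  shows "T \<in> GL"
  unfolding GL_def by (auto intro!: exI[where x = S] blinfun_eqI simp: assms)

lemma binv_eqI:
  assumes "\<And>x. blinfun_apply S (blinfun_apply T x) = x" "\<And>x. blinfun_apply T (blinfun_apply S x) = x"
  shows "binv T = S"
  by (rule blinfun_eqI) (metis GLI[OF assms] assms(2) binv_apply(1))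

lemma GL_compose: "S \<in> GL \<Longrightarrow> T \<in> GL \<Longrightarrow> S o\<^sub>L T \<in> GL"
  by (rule GLI[where S = "binv T o\<^sub>L binv S"]) simp_all

lemma id_in_GL: "id_blinfun \<in> GL"
  by (rule GLI[where S = id_blinfun]) simp_all

lemma GL_scaleR: "T \<in> GL \<Longrightarrow> c \<noteq> 0 \<Longrightarrow> c *\<^sub>R T \<in> GL"
  by (rule GLI[where S = "(1 / c) *\<^sub>R binv T"]) (simp_all add: blinfun.bilinear_simps)

lemma GL_uminus: "T \<in> GL \<Longrightarrow> - T \<in> GL"
  using GL_scaleR[of T "-1"] by simp

lemma binv_uminus: "T \<in> GL \<Longrightarrow> binv (- T) = - binv T"
  by (rule binv_eqI) (simp_all add: blinfun.bilinear_simps)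

lemma GL_if_surj_bounded_below:
  fixes T :: "'a::real_normed_vector \<Rightarrow>\<^sub>L 'a"
  assumes "0 < c" and below: "\<And>x. c * norm x \<le> norm (blinfun_apply T x)"
    and "\<And>y. \<exists>x. blinfun_apply T x = y"
  shows "T \<in> GL"
proof -
  obtain S where S: "\<And>y. blinfun_apply T (S y) = y" using assms(3) by metis
  have inj: "x = y" if "blinfun_apply T x = blinfun_apply T y" for x y
    using below[of "x - y"] that \<open>0 < c\<close> by (simp add: blinfun.diff_right mult_le_0_iff)
  have bl: "bounded_linear S"
  proof (rule bounded_linear_intro[where K = "1 / c"])
    show "S (x + y) = S x + S y" for x y by (rule inj) (simp add: S blinfun.add_right)
    show "S (r *\<^sub>R x) = r *\<^sub>R S x" for r x by (rule inj) (simp add: S blinfun.scaleR_right)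
    show "norm (S x) \<le> norm x * (1 / c)" for x
      using below[of "S x"] \<open>0 < c\<close> by (simp add: S field_simps)
  qed
  show ?thesis
    by (rule GLI[where S = "Blinfun S"]) (simp_all add: bounded_linear_Blinfun_apply[OF bl] S inj)
qed

lemma GL_bounded_below:
  assumes "G \<in> GL" "norm (binv G) \<le> C"
  shows "norm x \<le> C * norm (blinfun_apply G x)"
  using norm_blinfun[of "binv G" "blinfun_apply G x"] assms
    mult_right_mono[OF assms(2), of "norm (blinfun_apply G x)"] by simp

text \<open>Surjectivity is the Banach fixed point theorem for \<open>binv G (y - D x)\<close>, the
  Neumann series in disguise. The admissible size of \<open>D\<close> depends only on the bound
  \<open>C\<close>, which allows radii that are uniform over families of operators.\<close>

lemma GL_perturb:
  fixes G D :: "'a::banach \<Rightarrow>\<^sub>L 'a"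
  assumes G: "G \<in> GL" and C: "norm (binv G) \<le> C" and small: "C * norm D < 1"
  shows "G + D \<in> GL" and "norm (binv (G + D)) \<le> C / (1 - C * norm D)"
proof -
  have C0: "0 \<le> C" using C norm_ge_zero order_trans by blast
  have below: "norm x * (1 - C * norm D) \<le> C * norm (blinfun_apply (G + D) x)" for x
  proof -
    have "norm x \<le> C * norm (blinfun_apply (G + D) x - blinfun_apply D x)"
      using GL_bounded_below[OF G C, of x] by (simp add: blinfun.bilinear_simps)
    also have "\<dots> \<le> C * (norm (blinfun_apply (G + D) x) + norm D * norm x)"
      using norm_triangle_ineq4[of "blinfun_apply (G + D) x" "blinfun_apply D x"] norm_blinfun[of D x]
      by (intro mult_left_mono C0) linarith
    finally show ?thesis by (simp add: algebra_simps)
  qed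
  show GD: "G + D \<in> GL"
  proof (rule GL_if_surj_bounded_below)
    \<comment> \<open>The denominator is \<open>C + 1\<close> because \<open>C\<close> may be
      0.\<close>
    show "0 < (1 - C * norm D) / (C + 1)" using C0 small by simp
    show "(1 - C * norm D) / (C + 1) * norm x \<le> norm (blinfun_apply (G + D) x)" for x
    proof -
      have "norm x * (1 - C * norm D) \<le> (C + 1) * norm (blinfun_apply (G + D) x)"
        using below[of x] norm_ge_zero[of "blinfun_apply (G + D) x"]
        unfolding distrib_right mult_1_left by linarith
      then show ?thesis using C0 by (simp add: pos_divide_le_eq mult.commute)
    qed
    show "\<exists>x. blinfun_apply (G + D) x = y" for y
    proof -
      define h where "h x = blinfun_apply (binv G) (y - blinfun_apply D x)" for x
      have "dist (h u) (h v) \<le> (C * norm D) * dist u v" for u v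
      proof -
        have "h u - h v = blinfun_apply (binv G) (blinfun_apply D (v - u))"
          by (simp add: h_def flip: blinfun.diff_right)
        then have "norm (h u - h v) \<le> norm (binv G) * norm (blinfun_apply D (v - u))"
          by (simp add: norm_blinfun)
        also have "\<dots> \<le> C * (norm D * norm (v - u))"
          using C C0 by (intro mult_mono norm_blinfun) auto
        finally show ?thesis by (simp add: dist_norm norm_minus_commute mult.assoc)
      qed
      then obtain x where "h x = x"
        using banach_fix_type[of "C * norm D" h] C0 small by auto
      then have "blinfun_apply G (h x) = blinfun_apply G x" by simp
      then have "y - blinfun_apply D x = blinfun_apply G x" using G by (simp add: h_def)
      then have "blinfun_apply (G + D) x = y" by (simp add: blinfun.bilinear_simps algebra_simps)
      then show ?thesis by blast
    qed
  qed
  show "norm (binv (G + D)) \<le> C / (1 - C * norm D)"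
  proof (rule norm_blinfun_bound)
    show "0 \<le> C / (1 - C * norm D)" using C0 small by simp
    show "norm (blinfun_apply (binv (G + D)) y) \<le> C / (1 - C * norm D) * norm y" for y
      using below[of "blinfun_apply (binv (G + D)) y"] GD small by (simp add: field_simps)
  qed
qed

lemma GL_diff_scaleR_id:
  fixes T :: "'a::banach \<Rightarrow>\<^sub>L 'a"
  assumes "norm T < \<bar>c\<bar>"
  shows "T - c *\<^sub>R id_blinfun \<in> GL"
proof -
  have c: "c \<noteq> 0" using assms by auto
  have G: "(- c) *\<^sub>R id_blinfun \<in> (GL :: ('a \<Rightarrow>\<^sub>L 'a) set)" using c by (intro GL_scaleR id_in_GL) simp
  have "binv ((- c) *\<^sub>R id_blinfun :: 'a \<Rightarrow>\<^sub>L 'a) = (- 1 / c) *\<^sub>R id_blinfun"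
    using c by (intro binv_eqI) (simp_all add: blinfun.bilinear_simps)
  then have "norm (binv ((- c) *\<^sub>R id_blinfun :: 'a \<Rightarrow>\<^sub>L 'a)) \<le> 1 / \<bar>c\<bar>"
    using norm_blinfun_id_le[where 'a = 'a] c by (simp add: divide_right_mono)
  from GL_perturb(1)[OF G this, of T] show ?thesis using assms c by (simp add: algebra_simps)
qed

lemma GL_ball:
  fixes G :: "'a::banach \<Rightarrow>\<^sub>L 'a"
  assumes "G \<in> GL"
  obtains \<delta> where "0 < \<delta>" "\<And>H. norm (H - G) < \<delta> \<Longrightarrow> H \<in> GL"
proof
  show "0 < 1 / (norm (binv G) + 1)" by (simp add: add_nonneg_pos)
  show "H \<in> GL" if "norm (H - G) < 1 / (norm (binv G) + 1)" for H
  proof -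
    have "(norm (binv G) + 1) * norm (H - G) < 1"
      using that by (simp add: pos_less_divide_eq[OF add_nonneg_pos] mult.commute)
    then show ?thesis using GL_perturb(1)[OF assms, of "norm (binv G) + 1" "H - G"] by simp
  qed
qed

lemma open_GL: "open (GL :: ('a::banach \<Rightarrow>\<^sub>L 'a) set)"
  unfolding open_dist dist_norm using GL_ball by metis

lemma continuous_on_binv: "continuous_on GL (binv :: ('a::banach \<Rightarrow>\<^sub>L 'a) \<Rightarrow> _)"
  unfolding continuous_on_def
proof
  fix G :: "'a \<Rightarrow>\<^sub>L 'a" assume G: "G \<in> GL"
  define C where "C = norm (binv G) + 1"
  have C: "norm (binv G) \<le> C" "0 < C" by (auto simp: C_def add_nonneg_pos)
  have bound: "norm (binv H - binv G) \<le> 2 * C * C * norm (H - G)" if "norm (H - G) < 1 / (2 * C)" for H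
  proof -
    have small: "C * norm (H - G) < 1 / 2" using that C by (simp add: field_simps)
    then have H: "H \<in> GL"
      using GL_perturb(1)[OF G C(1), of "H - G"] by simp
    have "norm (binv H) \<le> C / (1 - C * norm (H - G))"
      using GL_perturb(2)[OF G C(1), of "H - G"] small by simp
    also have "\<dots> \<le> C / (1 / 2)" using small C by (intro divide_left_mono) auto
    finally have bH: "norm (binv H) \<le> 2 * C" by simp
    \<comment> \<open>The resolvent identity; together with \<open>norm (binv H) \<le> 2 * C\<close>
      it gives a local Lipschitz bound.\<close>
    have "binv H - binv G = binv H o\<^sub>L ((G - H) o\<^sub>L binv G)"
      by (rule blinfun_eqI) (simp add: blinfun.bilinear_simps G H)
    then have "norm (binv H - binv G) \<le> norm (binv H) * (norm (G - H) * norm (binv G))"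
      using order_trans[OF norm_blinfun_compose mult_left_mono[OF norm_blinfun_compose norm_ge_zero]] by simp
    also have "\<dots> \<le> (2 * C) * (norm (H - G) * C)"
      using C bH by (intro mult_mono) (auto simp: norm_minus_commute)
    finally show ?thesis by (simp add: mult_ac)
  qed
  have lim: "((\<lambda>H. H) \<longlongrightarrow> G) (at G within GL)" by (rule tendsto_ident_at)
  show "(binv \<longlongrightarrow> binv G) (at G within GL)"
  proof (rule LIM_zero_cancel[OF Lim_null_comparison])
    show "\<forall>\<^sub>F H in at G within GL. norm (binv H - binv G) \<le> 2 * C * C * norm (H - G)"
      using tendstoD[OF lim, of "1 / (2 * C)"] C
      by (auto simp: dist_norm elim!: eventually_mono intro: bound)
    have "((\<lambda>H. 2 * C * C * norm (H - G)) \<longlongrightarrow> 2 * C * C * norm (G - G)) (at G within GL)"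
      by (intro tendsto_intros)
    then show "((\<lambda>H. 2 * C * C * norm (H - G)) \<longlongrightarrow> 0) (at G within GL)" by simp
  qed
qed

definition rank_one :: "('a::real_normed_vector \<Rightarrow>\<^sub>L real) \<Rightarrow> 'a \<Rightarrow> ('a \<Rightarrow>\<^sub>L 'a)" where
  "rank_one g v = blinfun_scaleR_left v o\<^sub>L g"

lemma rank_one_apply [simp]: "blinfun_apply (rank_one g v) x = blinfun_apply g x *\<^sub>R v"
  by (simp add: rank_one_def)

lemma GL_id_plus_rank_one:
  assumes "1 + blinfun_apply g v \<noteq> 0"
  shows "id_blinfun + rank_one g v \<in> GL"
proof -
  define b where "b = blinfun_apply g v"
  \<comment> \<open>The coefficient of the Sherman-Morrison formula for the inverse.\<close>
  define k where "k = 1 / (1 + b)"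
  have "k * (1 + b) = 1" using assms by (simp add: k_def b_def)
  moreover have "k * (a + a * b) = a * (k * (1 + b))" for a by (simp add: algebra_simps)
  ultimately have k: "a - k * (a + a * b) = 0" for a by simp
  show ?thesis
  proof (rule GLI[where S = "id_blinfun - k *\<^sub>R rank_one g v"])
    fix x
    define a where "a = blinfun_apply g x"
    have "blinfun_apply (id_blinfun - k *\<^sub>R rank_one g v) (blinfun_apply (id_blinfun + rank_one g v) x) =
        x + (a - k * (a + a * b)) *\<^sub>R v"
      by (simp add: blinfun.bilinear_simps algebra_simps a_def b_def)
    then show "blinfun_apply (id_blinfun - k *\<^sub>R rank_one g v) (blinfun_apply (id_blinfun + rank_one g v) x) = x"
      unfolding k by simp
    have "blinfun_apply (id_blinfun + rank_one g v) (blinfun_apply (id_blinfun - k *\<^sub>R rank_one g v) x) =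
        x + (a - k * (a + a * b)) *\<^sub>R v"
      by (simp add: blinfun.bilinear_simps algebra_simps a_def b_def)
    then show "blinfun_apply (id_blinfun + rank_one g v) (blinfun_apply (id_blinfun - k *\<^sub>R rank_one g v) x) = x"
      unfolding k by simp
  qed
qed

section \<open>Determinants relative to a finite-codimensional subspace\<close>

text \<open>A biorthogonal system: the functionals cut out a closed subspace of codimension
  \<open>n\<close>, and the vectors span a complement with the functionals as coordinates.\<close>

definition frame :: "nat \<Rightarrow> (nat \<Rightarrow> 'a::real_normed_vector \<Rightarrow>\<^sub>L real) \<Rightarrow> (nat \<Rightarrow> 'a) \<Rightarrow> bool" where
  "frame n f e \<longleftrightarrow> (\<forall>i<n. \<forall>j<n. blinfun_apply (f i) (e j) = (if i = j then 1 else 0))"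

definition fkernel :: "nat \<Rightarrow> (nat \<Rightarrow> 'a::real_normed_vector \<Rightarrow>\<^sub>L real) \<Rightarrow> 'a set" where
  "fkernel n f = {x. \<forall>i<n. blinfun_apply (f i) x = 0}"

lemma frame_sum:
  assumes "frame n f e" "i < n"
  shows "(\<Sum>j<n. c j * blinfun_apply (f i) (e j)) = c i"
proof -
  have "(\<Sum>j<n. c j * blinfun_apply (f i) (e j)) = (\<Sum>j<n. if j = i then c j else 0)"
    using assms by (intro sum.cong) (auto simp: frame_def)
  then show ?thesis using assms(2) by simp
qed

lemma frame_kernel_part:
  assumes "frame n f e"
  shows "x - (\<Sum>j<n. blinfun_apply (f j) x *\<^sub>R e j) \<in> fkernel n f"
  using frame_sum[OF assms] by (simp add: fkernel_def blinfun.bilinear_simps blinfun.sum_right)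

text \<open>Gram-Schmidt for functionals: what remains of \<open>g\<close> after removing its
  components is either 0, or nonzero at a vector of the current kernel, which after scaling becomes
  the new dual vector. Keeping the old frame as an initial segment lets a prescribed pair survive
  every refinement.\<close>

lemma frame_extend:
  assumes "finite F" "frame n f e"
  shows "\<exists>m f' e'. frame m f' e' \<and> n \<le> m \<and> (\<forall>i<n. f' i = f i \<and> e' i = e i) \<and> fkernel m f' \<subseteq> ann F"
  using assms(1)
proof (induction F rule: finite_induct)
  case empty
  then show ?case using assms(2) by (intro exI[where x = n] exI[where x = f] exI[where x = e]) (auto simp: ann_def)
next
  case (insert g F)
  then obtain m f' e' where fr: "frame m f' e'" and ext: "n \<le> m" "\<forall>i<n. f' i = f i \<and> e' i = e i"
    and ker: "fkernel m f' \<subseteq> ann F" by blast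
  \<comment> \<open>\<open>h\<close> vanishes on all \<open>e' i\<close> and coincides with
    \<open>g\<close> on the current kernel.\<close>
  define h where "h = g - (\<Sum>j<m. blinfun_apply g (e' j) *\<^sub>R f' j)"
  have h: "blinfun_apply h x = blinfun_apply g x - (\<Sum>j<m. blinfun_apply g (e' j) * blinfun_apply (f' j) x)" for x
    by (simp add: h_def blinfun.bilinear_simps blinfun.sum_left)
  have hg: "blinfun_apply h x = blinfun_apply g x" if "x \<in> fkernel m f'" for x
    using that by (simp add: h fkernel_def)
  have he: "blinfun_apply h (e' i) = 0" if "i < m" for i
  proof -
    have "(\<Sum>j<m. blinfun_apply g (e' j) * blinfun_apply (f' j) (e' i)) =
        (\<Sum>j<m. if j = i then blinfun_apply g (e' j) else 0)"
      using fr that by (intro sum.cong) (auto simp: frame_def)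
    then show ?thesis using that by (simp add: h)
  qed
  show ?case
  proof (cases "h = 0")
    case True
    then have "fkernel m f' \<subseteq> ann (insert g F)" using ker hg by (auto simp: ann_def)
    then show ?thesis using fr ext by blast
  next
    case False
    then obtain x where x: "blinfun_apply h x \<noteq> 0" by (metis blinfun_eqI zero_blinfun.rep_eq)
    define u where "u = x - (\<Sum>j<m. blinfun_apply (f' j) x *\<^sub>R e' j)"
    have u: "u \<in> fkernel m f'" unfolding u_def by (rule frame_kernel_part[OF fr])
    have hu: "blinfun_apply h u = blinfun_apply h x"
      by (simp add: u_def blinfun.bilinear_simps blinfun.sum_right he)
    define v where "v = (1 / blinfun_apply h x) *\<^sub>R u"
    have "frame (Suc m) (f'(m := h)) (e'(m := v))"
      using fr u hu he x unfolding frame_def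
      by (auto simp: less_Suc_eq v_def fkernel_def blinfun.bilinear_simps)
    moreover have "fkernel (Suc m) (f'(m := h)) \<subseteq> ann (insert g F)"
    proof
      fix y assume y: "y \<in> fkernel (Suc m) (f'(m := h))"
      then have "y \<in> fkernel m f'" unfolding fkernel_def by (auto split: if_splits simp: less_Suc_eq)
      moreover have "blinfun_apply h y = 0" using y by (auto simp: fkernel_def)
      ultimately show "y \<in> ann (insert g F)" using hg ker by (auto simp: ann_def)
    qed
    moreover have "\<forall>i<n. (f'(m := h)) i = f i \<and> (e'(m := v)) i = e i" using ext by auto
    ultimately show ?thesis using ext(1) le_SucI by blast
  qed
qed

definition cdet :: "nat \<Rightarrow> (nat \<Rightarrow> 'a::real_normed_vector \<Rightarrow>\<^sub>L real) \<Rightarrow> (nat \<Rightarrow> 'a) \<Rightarrow>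
    ('a \<Rightarrow>\<^sub>L 'a) \<Rightarrow> ('a \<Rightarrow>\<^sub>L 'a) \<Rightarrow> real" where
  "cdet n f e G H =
     Determinant.det (Matrix.mat n n (\<lambda>(i, j). blinfun_apply (f i) (blinfun_apply (binv G) (blinfun_apply H (e j)))))"

definition agree :: "nat \<Rightarrow> (nat \<Rightarrow> 'a::real_normed_vector \<Rightarrow>\<^sub>L real) \<Rightarrow>
    ('a \<Rightarrow>\<^sub>L 'a) \<Rightarrow> ('a \<Rightarrow>\<^sub>L 'a) \<Rightarrow> bool" where
  "agree n f G H \<longleftrightarrow> (\<forall>x\<in>fkernel n f. blinfun_apply G x = blinfun_apply H x)"

text \<open>\<open>binv G o\<^sub>L H\<close> is the identity on the kernel of the frame, so \<open>cdet\<close> is the determinant of the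
  induced map on the finite-dimensional quotient; hence multiplicativity.\<close>

lemma cdet_mult:
  assumes fr: "frame n f e" and GL: "G \<in> GL" "H \<in> GL" and GH: "agree n f G H"
  shows "cdet n f e G H * cdet n f e H J = cdet n f e G J"
proof -
  define U where "U = binv G o\<^sub>L H"
  define V where "V = binv H o\<^sub>L J"
  \<comment> \<open>\<open>U\<close> fixes the kernel part of \<open>y\<close>, which
    \<open>f i\<close> kills, so only the coordinates of \<open>y\<close> contribute. This is the
    row expansion needed for the matrix product.\<close>
  have fU: "blinfun_apply (f i) (blinfun_apply U y) =
      (\<Sum>k<n. blinfun_apply (f i) (blinfun_apply U (e k)) * blinfun_apply (f k) y)" if "i < n" for i y
  proof -
    define w where "w = y - (\<Sum>j<n. blinfun_apply (f j) y *\<^sub>R e j)"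
    have w: "w \<in> fkernel n f" unfolding w_def by (rule frame_kernel_part[OF fr])
    then have "blinfun_apply H w = blinfun_apply G w" using GH by (simp add: agree_def)
    then have "blinfun_apply U w = w" using GL by (simp add: U_def)
    then have "blinfun_apply (f i) (blinfun_apply U w) = 0" using w that by (simp add: fkernel_def)
    then show ?thesis
      by (simp add: w_def blinfun.bilinear_simps blinfun.sum_right mult.commute)
  qed
  define A where "A = Matrix.mat n n (\<lambda>(i, j). blinfun_apply (f i) (blinfun_apply U (e j)))"
  define B where "B = Matrix.mat n n (\<lambda>(i, j). blinfun_apply (f i) (blinfun_apply V (e j)))"
  have AB: "A \<in> carrier_mat n n" "B \<in> carrier_mat n n" by (simp_all add: A_def B_def)
  have "A * B = Matrix.mat n n (\<lambda>(i, j). blinfun_apply (f i) (blinfun_apply U (blinfun_apply V (e j))))"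
  proof (rule eq_matI)
    fix i j assume "i < dim_row (Matrix.mat n n (\<lambda>(i, j). blinfun_apply (f i) (blinfun_apply U (blinfun_apply V (e j)))))"
      "j < dim_col (Matrix.mat n n (\<lambda>(i, j). blinfun_apply (f i) (blinfun_apply U (blinfun_apply V (e j)))))"
    then have ij: "i < n" "j < n" by simp_all
    then have "(A * B) $$ (i, j) =
        (\<Sum>k<n. blinfun_apply (f i) (blinfun_apply U (e k)) * blinfun_apply (f k) (blinfun_apply V (e j)))"
      by (simp add: A_def B_def scalar_prod_def atLeast0LessThan)
    then show "(A * B) $$ (i, j) = Matrix.mat n n (\<lambda>(i, j). blinfun_apply (f i) (blinfun_apply U (blinfun_apply V (e j)))) $$ (i, j)"
      using ij fU[OF ij(1), of "blinfun_apply V (e j)"] by simp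
  qed (use AB in auto)
  moreover have "blinfun_apply U (blinfun_apply V y) = blinfun_apply (binv G) (blinfun_apply J y)" for y
    using GL by (simp add: U_def V_def)
  ultimately have "A * B = Matrix.mat n n (\<lambda>(i, j). blinfun_apply (f i) (blinfun_apply (binv G) (blinfun_apply J (e j))))"
    by simp
  then have "Determinant.det A * Determinant.det B = cdet n f e G J"
    using Determinant.det_mult[OF AB] by (simp add: cdet_def)
  then show ?thesis by (simp add: A_def B_def U_def V_def cdet_def)
qed

lemma cdet_refl:
  assumes fr: "frame n f e" and "G \<in> GL"
  shows "cdet n f e G G = 1"
proof -
  have "Matrix.mat n n (\<lambda>(i, j). blinfun_apply (f i) (blinfun_apply (binv G) (blinfun_apply G (e j)))) = 1\<^sub>m n"
    by (rule eq_matI) (use assms in \<open>auto simp: frame_def\<close>)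
  then show ?thesis by (simp add: cdet_def)
qed

lemma agree_sym: "agree n f G H \<Longrightarrow> agree n f H G"
  by (simp add: agree_def)

lemma agree_trans: "agree n f G H \<Longrightarrow> agree n f H J \<Longrightarrow> agree n f G J"
  by (simp add: agree_def)

lemma cdet_nonzero:
  assumes "frame n f e" "G \<in> GL" "H \<in> GL" "agree n f G H"
  shows "cdet n f e G H \<noteq> 0"
  using cdet_mult[OF assms, of G] cdet_refl[OF assms(1,2)] by auto

text \<open>\<open>H\<close> is \<open>G\<close> with the image of \<open>e j\<close> replaced by
  \<open>x\<close>, so the relative matrix is the identity with one column replaced and Cramer's
  rule gives its determinant. This turns bounds on determinants into bounds on coordinates.\<close>

lemma cdet_exchange:
  fixes G :: "'a::real_normed_vector \<Rightarrow>\<^sub>L 'a"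
  assumes fr: "frame n f e" and G: "G \<in> GL" and j: "j < n"
    and H: "H = G + rank_one (f j) (x - blinfun_apply G (e j))"
  shows "agree n f G H" and "cdet n f e G H = blinfun_apply (f j) (blinfun_apply (binv G) x)"
    and "blinfun_apply (f j) (blinfun_apply (binv G) x) \<noteq> 0 \<Longrightarrow> H \<in> GL"
    and "\<And>k. k < n \<Longrightarrow> blinfun_apply H (e k) = (if k = j then x else blinfun_apply G (e k))"
proof -
  show "agree n f G H" using j by (simp add: agree_def H blinfun.bilinear_simps fkernel_def)
  show He: "\<And>k. k < n \<Longrightarrow> blinfun_apply H (e k) = (if k = j then x else blinfun_apply G (e k))"
    using fr j by (auto simp: H blinfun.bilinear_simps frame_def)
  define v where "v = Matrix.vec n (\<lambda>i. blinfun_apply (f i) (blinfun_apply (binv G) x))"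
  have v: "v \<in> carrier_vec n" by (simp add: v_def)
  have "Matrix.mat n n (\<lambda>(i, k). blinfun_apply (f i) (blinfun_apply (binv G) (blinfun_apply H (e k)))) =
      replace_col (1\<^sub>m n) (1\<^sub>m n *\<^sub>v v) j"
    using v by (intro eq_matI) (use fr G He in \<open>auto simp: replace_col_def frame_def v_def\<close>)
  then show "cdet n f e G H = blinfun_apply (f j) (blinfun_apply (binv G) x)"
    using cramer_lemma_mat[OF one_carrier_mat v j] j by (simp add: cdet_def v_def)
  assume nz: "blinfun_apply (f j) (blinfun_apply (binv G) x) \<noteq> 0"
  have "H = G o\<^sub>L (id_blinfun + rank_one (f j) (blinfun_apply (binv G) x - e j))"
    by (rule blinfun_eqI) (simp add: H G blinfun.bilinear_simps)
  \<comment> \<open>Because \<open>f j\<close> is 1 at \<open>e j\<close>, this number is exactly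
    the coordinate assumed to be nonzero.\<close>
  moreover have "1 + blinfun_apply (f j) (blinfun_apply (binv G) x - e j) \<noteq> 0"
    using nz fr j by (simp add: blinfun.bilinear_simps frame_def)
  ultimately show "H \<in> GL" using GL_compose[OF G GL_id_plus_rank_one] by simp
qed

text \<open>Crude estimate from the Leibniz formula; it serves to make a supremum of determinants
  finite.\<close>

lemma abs_det_le:
  fixes h :: "nat \<times> nat \<Rightarrow> real"
  assumes "\<And>i j. i < n \<Longrightarrow> j < n \<Longrightarrow> \<bar>h (i, j)\<bar> \<le> b"
  shows "\<bar>Determinant.det (Matrix.mat n n h)\<bar> \<le> fact n * b ^ n"
proof -
  have "\<bar>Determinant.det (Matrix.mat n n h)\<bar> \<le>
      (\<Sum>p\<in>{p. p permutes {0..<n}}. \<bar>signof p * (\<Prod>i=0..<n. Matrix.mat n n h $$ (i, p i))\<bar>)"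
    using sum_abs by (simp add: det_def'[where n = n])
  also have "\<dots> \<le> (\<Sum>p\<in>{p. p permutes {0..<n}}. b ^ n)"
  proof (rule sum_mono)
    fix p assume "p \<in> {p. p permutes {0..<n}}"
    then have p: "i < n \<Longrightarrow> p i < n" for i using permutes_in_image[of p "{0..<n}" i] by auto
    have "\<bar>signof p * (\<Prod>i=0..<n. Matrix.mat n n h $$ (i, p i))\<bar> = (\<Prod>i=0..<n. \<bar>Matrix.mat n n h $$ (i, p i)\<bar>)"
      by (simp add: abs_mult abs_prod sign_def)
    also have "\<dots> \<le> (\<Prod>i=0..<n. b)" using assms p by (intro prod_mono) auto
    finally show "\<bar>signof p * (\<Prod>i=0..<n. Matrix.mat n n h $$ (i, p i))\<bar> \<le> b ^ n" by simp
  qed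
  finally show ?thesis by (simp add: card_permutations)
qed

section \<open>Finite-rank correctors\<close>

text \<open>Vanishing on \<open>fkernel n f\<close> limits the rank of \<open>K\<close> to
  \<open>n\<close>, so on a Banach space the existence of an admissible \<open>K\<close> makes
  \<open>L\<close> Fredholm of index 0.\<close>

definition adm :: "nat \<Rightarrow> (nat \<Rightarrow> 'a::real_normed_vector \<Rightarrow>\<^sub>L real) \<Rightarrow> ('a \<Rightarrow>\<^sub>L 'a) \<Rightarrow> ('a \<Rightarrow>\<^sub>L 'a) \<Rightarrow> bool" where
  "adm n f L K \<longleftrightarrow> (\<forall>x\<in>fkernel n f. blinfun_apply K x = 0) \<and> L + K \<in> GL"

lemma adm_agree: "adm n f L K \<Longrightarrow> adm n f L K' \<Longrightarrow> agree n f (L + K) (L + K')"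
  by (simp add: adm_def agree_def blinfun.bilinear_simps)

lemma adm_zero: "adm n f L 0 \<longleftrightarrow> L \<in> GL"
  by (simp add: adm_def)

text \<open>Precomposing \<open>L + K\<close> with the map that scales the span of the
  \<open>e j\<close> by a small \<open>t\<close> and fixes the kernel of the frame shrinks the
  images of the \<open>e j\<close> and changes nothing on that kernel.\<close>

lemma adm_normalized:
  fixes L :: "'a::real_normed_vector \<Rightarrow>\<^sub>L 'a"
  assumes fr: "frame n f e" and "adm n f L K"
  obtains G where "G \<in> GL" "agree n f L G" "\<And>j. j < n \<Longrightarrow> norm (blinfun_apply G (e j)) \<le> 1"
proof -
  define t where "t = 1 / (1 + (\<Sum>j<n. norm (blinfun_apply (L + K) (e j))))"
  have s0: "0 \<le> (\<Sum>j<n. norm (blinfun_apply (L + K) (e j)))" by (simp add: sum_nonneg)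
  then have t: "0 < t" by (auto simp: t_def intro!: divide_pos_pos add_pos_nonneg)
  define Q where "Q = (\<Sum>j<n. rank_one (f j) (e j))"
  have Q: "blinfun_apply Q x = (\<Sum>j<n. blinfun_apply (f j) x *\<^sub>R e j)" for x
    by (simp add: Q_def blinfun.sum_left)
  have fQ: "blinfun_apply (f i) (blinfun_apply Q x) = blinfun_apply (f i) x" if "i < n" for i x
    using frame_sum[OF fr that] by (simp add: Q blinfun.sum_right blinfun.scaleR_right)
  have QQ: "blinfun_apply Q (blinfun_apply Q x) = blinfun_apply Q x" for x
  proof -
    have "blinfun_apply Q (blinfun_apply Q x) = (\<Sum>j<n. blinfun_apply (f j) (blinfun_apply Q x) *\<^sub>R e j)"
      by (rule Q)
    also have "\<dots> = (\<Sum>j<n. blinfun_apply (f j) x *\<^sub>R e j)" by (intro sum.cong) (simp_all add: fQ)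
    finally show ?thesis by (simp only: Q[of x])
  qed
  define A where "A s = id_blinfun + (s - 1) *\<^sub>R Q" for s :: real
  have A: "blinfun_apply (A s) x = x + (s - 1) *\<^sub>R blinfun_apply Q x" for s x
    by (simp add: A_def blinfun.bilinear_simps)
  have AA: "blinfun_apply (A s) (blinfun_apply (A r) x) = x" if "s * r = 1" for s r x
  proof -
    have "blinfun_apply (A s) (blinfun_apply (A r) x) =
        x + ((r - 1) + (s - 1) + (s - 1) * (r - 1)) *\<^sub>R blinfun_apply Q x"
      by (simp add: A blinfun.bilinear_simps QQ algebra_simps)
    also have "(r - 1) + (s - 1) + (s - 1) * (r - 1) = 0" using that by (simp add: algebra_simps)
    finally show ?thesis by simp
  qed
  have AGL: "A t \<in> GL" using t by (intro GLI[where S = "A (1 / t)"] AA) simp_all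
  have Qe: "blinfun_apply Q (e k) = e k" if "k < n" for k
  proof -
    have "blinfun_apply Q (e k) = (\<Sum>j<n. if j = k then e j else 0)"
      unfolding Q using fr that by (intro sum.cong) (auto simp: frame_def)
    then show ?thesis using that by simp
  qed
  show thesis
  proof
    show "(L + K) o\<^sub>L A t \<in> GL" using assms(2) by (intro GL_compose AGL) (simp add: adm_def)
    show "agree n f L ((L + K) o\<^sub>L A t)"
      using assms(2) by (simp add: agree_def adm_def A Q fkernel_def blinfun.bilinear_simps)
    show "norm (blinfun_apply ((L + K) o\<^sub>L A t) (e j)) \<le> 1" if "j < n" for j
    proof -
      have "blinfun_apply ((L + K) o\<^sub>L A t) (e j) = t *\<^sub>R blinfun_apply (L + K) (e j)"
        by (simp add: A Qe[OF that] algebra_simps flip: blinfun.scaleR_right)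
      moreover have "norm (blinfun_apply (L + K) (e j)) \<le> (\<Sum>j<n. norm (blinfun_apply (L + K) (e j)))"
        using that by (intro member_le_sum) auto
      ultimately show ?thesis using t s0 by (simp add: t_def)
    qed
  qed
qed

text \<open>An operator whose relative determinant is within a factor 2 of the maximum has, by Cramer's rule,
  coordinate functionals of norm at most 2. This bounds its inverse independently of \<open>L\<close>.\<close>

lemma adm_bounded_inverse:
  fixes L :: "'a::real_normed_vector \<Rightarrow>\<^sub>L 'a"
  assumes fr: "frame n f e" and "adm n f L K0" and "0 < c"
    and below: "\<And>x. x \<in> fkernel n f \<Longrightarrow> c * norm x \<le> norm (blinfun_apply L x)"
  obtains K where "adm n f L K" "norm (binv (L + K)) \<le> (1 + 2 * real n) / c + 2 * (\<Sum>j<n. norm (e j))"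
proof -
  \<comment> \<open>The competitors of a maximization as in Auerbach's lemma. Normalizing the images
    of the \<open>e j\<close> keeps their determinants relative to a fixed member bounded.\<close>
  define \<G> where "\<G> = {G \<in> GL. agree n f L G \<and> (\<forall>j<n. norm (blinfun_apply G (e j)) \<le> 1)}"
  obtain G1 where G1: "G1 \<in> \<G>" using adm_normalized[OF fr assms(2)] unfolding \<G>_def by blast
  then have G1GL: "G1 \<in> GL" and G1a: "agree n f L G1" by (auto simp: \<G>_def)
  define b where "b = (\<Sum>i<n. norm (f i)) * norm (binv G1)"
  have bound: "\<bar>cdet n f e G1 G\<bar> \<le> fact n * b ^ n" if G: "G \<in> \<G>" for G
    unfolding cdet_def
  proof (rule abs_det_le)
    fix i j assume ij: "i < n" "j < n"
    have "\<bar>blinfun_apply (f i) (blinfun_apply (binv G1) (blinfun_apply G (e j)))\<bar> \<le>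
        norm (f i) * norm (blinfun_apply (binv G1) (blinfun_apply G (e j)))"
      using norm_blinfun[of "f i"] by simp
    also have "\<dots> \<le> norm (f i) * (norm (binv G1) * norm (blinfun_apply G (e j)))"
      by (intro mult_left_mono norm_blinfun) simp
    also have "\<dots> \<le> norm (f i) * (norm (binv G1) * 1)"
      using G ij by (intro mult_left_mono) (auto simp: \<G>_def)
    also have "\<dots> \<le> b" unfolding b_def mult_1_right
      using ij by (intro mult_right_mono member_le_sum) auto
    finally show "\<bar>case (i, j) of (i, j) \<Rightarrow> blinfun_apply (f i) (blinfun_apply (binv G1) (blinfun_apply G (e j)))\<bar> \<le> b"
      by simp
  qed
  define D where "D = (\<lambda>G. \<bar>cdet n f e G1 G\<bar>) ` \<G>"
  have D: "bdd_above D" unfolding D_def using bound by (intro bdd_aboveI2) auto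
  have "1 \<in> D" unfolding D_def using G1 cdet_refl[OF fr G1GL] by (intro image_eqI[where x = G1]) auto
  then have "1 \<le> Sup D" by (intro cSup_upper D)
  then have "Sup D / 2 < Sup D" by simp
  then obtain d where "d \<in> D" "Sup D / 2 < d" using less_cSupE[of "Sup D / 2" D] \<open>1 \<in> D\<close> by blast
  then obtain G where G: "G \<in> \<G>" and half: "Sup D / 2 < \<bar>cdet n f e G1 G\<bar>" unfolding D_def by auto
  have le: "\<bar>cdet n f e G1 H\<bar> \<le> Sup D" if "H \<in> \<G>" for H
    using that by (intro cSup_upper D) (simp add: D_def)
  have GGL: "G \<in> GL" and Ga: "agree n f L G" and Ge: "\<And>j. j < n \<Longrightarrow> norm (blinfun_apply G (e j)) \<le> 1"
    using G by (auto simp: \<G>_def)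
  have coord1: "\<bar>blinfun_apply (f j) (blinfun_apply (binv G) x)\<bar> \<le> 2" if "j < n" "norm x \<le> 1" for j x
  proof (cases "blinfun_apply (f j) (blinfun_apply (binv G) x) = 0")
    case False
    \<comment> \<open>\<open>H\<close> is again a competitor, and passing from \<open>G\<close> to
      \<open>H\<close> multiplies the determinant by the coordinate in question.\<close>
    define H where "H = G + rank_one (f j) (x - blinfun_apply G (e j))"
    note ex = cdet_exchange[OF fr GGL that(1) H_def]
    have "H \<in> \<G>" unfolding \<G>_def using ex(3)[OF False] agree_trans[OF Ga ex(1)] ex(4) Ge that(2) by auto
    then have "\<bar>cdet n f e G1 G\<bar> * \<bar>blinfun_apply (f j) (blinfun_apply (binv G) x)\<bar> \<le> Sup D"
      using le[of H] cdet_mult[OF fr G1GL GGL agree_trans[OF agree_sym[OF G1a] Ga], of H]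
      by (simp add: ex(2) flip: abs_mult)
    also have "\<dots> \<le> \<bar>cdet n f e G1 G\<bar> * 2" using half by simp
    finally show ?thesis using half \<open>1 \<le> Sup D\<close> by (simp add: mult_le_cancel_left)
  qed simp
  have coord: "\<bar>blinfun_apply (f j) (blinfun_apply (binv G) x)\<bar> \<le> 2 * norm x" if "j < n" for j x
  proof (cases "x = 0")
    case False
    then show ?thesis using coord1[OF that, of "(1 / norm x) *\<^sub>R x"]
      by (simp add: blinfun.bilinear_simps abs_mult field_simps)
  qed (simp add: blinfun.bilinear_simps)
  define K where "K = G - L"
  have adm: "adm n f L K" using GGL Ga by (simp add: adm_def K_def agree_def blinfun.bilinear_simps)
  have "norm (binv G) \<le> (1 + 2 * real n) / c + 2 * (\<Sum>j<n. norm (e j))"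
  proof (rule norm_blinfun_bound)
    show "0 \<le> (1 + 2 * real n) / c + 2 * (\<Sum>j<n. norm (e j))" using \<open>0 < c\<close> by (simp add: sum_nonneg)
    fix y
    define x where "x = blinfun_apply (binv G) y"
    define a where "a j = blinfun_apply (f j) x" for j
    \<comment> \<open>The coordinates \<open>a j\<close> are controlled already. On the kernel part
      \<open>w\<close> the operator \<open>G\<close> is \<open>L\<close>, whose lower bound
      \<open>c\<close> recovers \<open>norm w\<close> from the image.\<close>
    define w where "w = x - (\<Sum>j<n. a j *\<^sub>R e j)"
    have a: "\<bar>a j\<bar> \<le> 2 * norm y" if "j < n" for j using coord[OF that] by (simp add: a_def x_def)
    have w: "w \<in> fkernel n f" unfolding w_def a_def by (rule frame_kernel_part[OF fr])
    have "blinfun_apply L w = blinfun_apply G w" using Ga w by (simp add: agree_def)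
    also have "\<dots> = y - (\<Sum>j<n. a j *\<^sub>R blinfun_apply G (e j))"
      using GGL by (simp add: w_def x_def blinfun.bilinear_simps blinfun.sum_right)
    finally have "norm (blinfun_apply L w) \<le> norm y + norm (\<Sum>j<n. a j *\<^sub>R blinfun_apply G (e j))"
      by (simp add: norm_triangle_ineq4)
    also have "norm (\<Sum>j<n. a j *\<^sub>R blinfun_apply G (e j)) \<le> (\<Sum>j<n. 2 * norm y * 1)"
    proof (rule order_trans[OF norm_sum sum_mono])
      fix j assume "j \<in> {..<n}"
      then show "norm (a j *\<^sub>R blinfun_apply G (e j)) \<le> 2 * norm y * 1"
        unfolding norm_scaleR using a Ge by (intro mult_mono) auto
    qed
    finally have "norm (blinfun_apply L w) \<le> (1 + 2 * real n) * norm y" by (simp add: algebra_simps)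
    then have "c * norm w \<le> (1 + 2 * real n) * norm y" using below[OF w] by simp
    then have nw: "norm w \<le> (1 + 2 * real n) / c * norm y" using \<open>0 < c\<close> by (simp add: field_simps)
    have "norm (\<Sum>j<n. a j *\<^sub>R e j) \<le> (\<Sum>j<n. 2 * norm y * norm (e j))"
    proof (rule order_trans[OF norm_sum sum_mono])
      fix j assume "j \<in> {..<n}"
      then show "norm (a j *\<^sub>R e j) \<le> 2 * norm y * norm (e j)"
        unfolding norm_scaleR using a by (intro mult_right_mono) auto
    qed
    also have "\<dots> = 2 * (\<Sum>j<n. norm (e j)) * norm y" by (simp add: sum_distrib_left sum_distrib_right mult_ac)
    finally have "norm x \<le> (1 + 2 * real n) / c * norm y + 2 * (\<Sum>j<n. norm (e j)) * norm y"
      using nw norm_triangle_ineq[of w "\<Sum>j<n. a j *\<^sub>R e j"] by (simp add: w_def)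
    then show "norm (blinfun_apply (binv G) y) \<le> ((1 + 2 * real n) / c + 2 * (\<Sum>j<n. norm (e j))) * norm y"
      by (simp add: x_def distrib_right)
  qed
  then show thesis using that[OF adm] by (simp add: K_def)
qed

text \<open>A corrector with bounded inverse keeps working for all operators within a radius that
  depends only on \<open>n\<close>, \<open>e\<close> and \<open>c\<close>. Around each
  \<open>r\<close>, existence of a corrector therefore passes between any two points whose operators
  lie within \<open>1 / (2 * C)\<close> of \<open>Lf r\<close>, and connectedness spreads it over
  \<open>D\<close>.\<close>

lemma adm_connected:
  fixes Lf :: "'q::metric_space \<Rightarrow> 'a::banach \<Rightarrow>\<^sub>L 'a"
  assumes fr: "frame n f e" and "connected D" and cont: "continuous_on D Lf" and "0 < c"
    and below: "\<And>q x. q \<in> D \<Longrightarrow> x \<in> fkernel n f \<Longrightarrow> c * norm x \<le> norm (blinfun_apply (Lf q) x)"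
    and "p \<in> D" "\<exists>K. adm n f (Lf p) K" "q \<in> D"
  shows "\<exists>K. adm n f (Lf q) K"
proof -
  define C where "C = (1 + 2 * real n) / c + 2 * (\<Sum>j<n. norm (e j))"
  have "0 < C" unfolding C_def using \<open>0 < c\<close> by (intro add_pos_nonneg divide_pos_pos) (auto simp: sum_nonneg)
  show ?thesis
  proof (rule connected_induction_simple[OF \<open>connected D\<close>, of p q])
    fix r assume r: "r \<in> D"
    define T where "T = D \<inter> Lf -` ball (Lf r) (1 / (2 * C))"
    have "openin (top_of_set D) T"
      unfolding T_def by (rule continuous_openin_preimage_gen[OF cont open_ball])
    moreover have "r \<in> T" using r \<open>0 < C\<close> by (simp add: T_def)
    moreover have "\<exists>K. adm n f (Lf y) K" if xy: "x \<in> T" "y \<in> T" and ex: "\<exists>K. adm n f (Lf x) K" for x y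
    proof -
      obtain K0 where "adm n f (Lf x) K0" using ex by blast
      then obtain K where K: "adm n f (Lf x) K" "norm (binv (Lf x + K)) \<le> C"
        using adm_bounded_inverse[OF fr _ \<open>0 < c\<close> below] xy(1) unfolding C_def T_def by blast
      have "dist (Lf y) (Lf x) < 1 / (2 * C) + 1 / (2 * C)"
        using xy by (intro dist_triangle_lt[of _ "Lf r"]) (auto simp: T_def dist_commute)
      then have small: "C * norm (Lf y - Lf x) < 1" using \<open>0 < C\<close> by (simp add: dist_norm field_simps)
      have "(Lf x + K) + (Lf y - Lf x) \<in> GL"
        by (rule GL_perturb(1)[OF _ K(2) small]) (use K(1) in \<open>simp add: adm_def\<close>)
      then have "adm n f (Lf y) K" using K(1) by (simp add: adm_def algebra_simps)
      then show ?thesis by blast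
    qed
    ultimately show "\<exists>T. openin (top_of_set D) T \<and> r \<in> T \<and>
        (\<forall>x\<in>T. \<forall>y\<in>T. (\<exists>K. adm n f (Lf x) K) \<longrightarrow> (\<exists>K. adm n f (Lf y) K))" by blast
  qed (use assms in auto)
qed

section \<open>Orientations and parity\<close>

text \<open>The Benevieri-Furi orientation of index-0 Fredholm operators: each perturbation \<open>K\<close> of finite rank making
  \<open>L + K\<close> invertible plays the role of a local trivialization, with the signs of relative determinants as transition
  functions. When \<open>L\<close> itself is invertible, \<open>K = 0\<close> is a canonical choice, which makes orientations at the
  end points of a path comparable.\<close>

definition orientation :: "nat \<Rightarrow> (nat \<Rightarrow> 'a::real_normed_vector \<Rightarrow>\<^sub>L real) \<Rightarrow> (nat \<Rightarrow> 'a) \<Rightarrow>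
    ('q::metric_space \<Rightarrow> 'a \<Rightarrow>\<^sub>L 'a) \<Rightarrow> 'q set \<Rightarrow> ('q \<Rightarrow> ('a \<Rightarrow>\<^sub>L 'a) \<Rightarrow> real) \<Rightarrow> bool" where
  "orientation n f e Lf D w \<longleftrightarrow>
     (\<forall>q\<in>D. \<forall>K. adm n f (Lf q) K \<longrightarrow> w q K \<in> {1, -1}) \<and>
     (\<forall>q\<in>D. \<forall>K K'. adm n f (Lf q) K \<longrightarrow> adm n f (Lf q) K' \<longrightarrow>
        w q K' = sgn (cdet n f e (Lf q + K) (Lf q + K')) * w q K) \<and>
     (\<forall>K. continuous_on {q \<in> D. adm n f (Lf q) K} (\<lambda>q. w q K))"

lemma orientationD:
  assumes "orientation n f e Lf D w"
  shows "\<And>q K. q \<in> D \<Longrightarrow> adm n f (Lf q) K \<Longrightarrow> w q K \<in> {1, -1}"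
    and "\<And>q K K'. q \<in> D \<Longrightarrow> adm n f (Lf q) K \<Longrightarrow> adm n f (Lf q) K' \<Longrightarrow>
        w q K' = sgn (cdet n f e (Lf q + K) (Lf q + K')) * w q K"
    and "\<And>K. continuous_on {q \<in> D. adm n f (Lf q) K} (\<lambda>q. w q K)"
  using assms unfolding orientation_def by blast+

lemma orientation_reparam:
  assumes w: "orientation n f e Lf D w" and "continuous_on D' \<phi>" "\<phi> ` D' \<subseteq> D"
  shows "orientation n f e (\<lambda>p. Lf (\<phi> p)) D' (\<lambda>p. w (\<phi> p))"
  unfolding orientation_def
proof (intro conjI ballI allI impI)
  fix K
  show "continuous_on {p \<in> D'. adm n f (Lf (\<phi> p)) K} (\<lambda>p. w (\<phi> p) K)"
    by (rule continuous_on_compose2[OF orientationD(3)[OF w, of K]])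
      (use assms in \<open>auto intro: continuous_on_subset\<close>)
qed (use orientationD[OF w] assms(3) in blast)+

lemma orientation_scale:
  assumes w: "orientation n f e Lf D w" and "c \<in> {1, -1}"
  shows "orientation n f e Lf D (\<lambda>q K. c * w q K)"
  unfolding orientation_def
proof (intro conjI ballI allI impI)
  fix q K assume "q \<in> D" "adm n f (Lf q) K"
  then show "c * w q K \<in> {1, -1}" using orientationD(1)[OF w, of q K] assms(2) by auto
next
  fix q K K' assume "q \<in> D" "adm n f (Lf q) K" "adm n f (Lf q) K'"
  then show "c * w q K' = sgn (cdet n f e (Lf q + K) (Lf q + K')) * (c * w q K)"
    using orientationD(2)[OF w, of q K K'] by simp
qed (intro continuous_intros orientationD(3)[OF w])

lemma continuous_on_cdet:
  fixes A B :: "'q::topological_space \<Rightarrow> 'a::banach \<Rightarrow>\<^sub>L 'a"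
  assumes "continuous_on S A" "continuous_on S B" "\<And>q. q \<in> S \<Longrightarrow> A q \<in> GL"
  shows "continuous_on S (\<lambda>q. cdet n f e (A q) (B q))"
proof -
  have "continuous_on S (\<lambda>q. binv (A q))"
    by (rule continuous_on_compose2[OF continuous_on_binv assms(1)]) (use assms(3) in auto)
  then have ent: "continuous_on S (\<lambda>q. blinfun_apply (f i) (blinfun_apply (binv (A q)) (blinfun_apply (B q) (e j))))" for i j
    using assms(2) by (intro continuous_intros)
  have "cdet n f e (A q) (B q) = (\<Sum>p\<in>{p. p permutes {0..<n}}.
      signof p * (\<Prod>i=0..<n. blinfun_apply (f i) (blinfun_apply (binv (A q)) (blinfun_apply (B q) (e (p i))))))" for q
    unfolding cdet_def
    by (subst det_def'[where n = n], simp)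
      (intro sum.cong refl arg_cong2[where f = "(*)"] prod.cong,
       use permutes_in_image in \<open>fastforce\<close>)
  then show ?thesis by (simp add: continuous_on_sum continuous_on_prod continuous_on_mult_left ent)
qed

lemma openin_adm:
  fixes Lf :: "'q::metric_space \<Rightarrow> 'a::banach \<Rightarrow>\<^sub>L 'a"
  assumes "continuous_on D Lf"
  shows "openin (top_of_set D) {q \<in> D. adm n f (Lf q) K}"
proof -
  have "continuous_on D (\<lambda>q. Lf q + K)" using assms by (intro continuous_intros)
  from continuous_openin_preimage_gen[OF this open_GL]
  show ?thesis
  proof (cases "\<forall>x\<in>fkernel n f. blinfun_apply K x = 0")
    case True
    then have "{q \<in> D. adm n f (Lf q) K} = D \<inter> (\<lambda>q. Lf q + K) -` GL" by (auto simp: adm_def)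
    then show ?thesis using \<open>openin _ _\<close> by simp
  next
    case False
    then have "{q \<in> D. adm n f (Lf q) K} = {}" by (auto simp: adm_def)
    then show ?thesis by (simp only: openin_empty)
  qed
qed

text \<open>A corrector valid on all of \<open>D\<close> is a global trivialization: the sign of
  every other corrector is measured against it.\<close>

lemma orientation_const:
  fixes Lf :: "'q::metric_space \<Rightarrow> 'a::banach \<Rightarrow>\<^sub>L 'a"
  assumes fr: "frame n f e" and cont: "continuous_on D Lf" and K0: "\<And>q. q \<in> D \<Longrightarrow> adm n f (Lf q) K0"
  shows "orientation n f e Lf D (\<lambda>q K. sgn (cdet n f e (Lf q + K0) (Lf q + K)))"
  unfolding orientation_def
proof (intro conjI ballI allI impI)
  have nz: "cdet n f e (Lf q + K0) (Lf q + K) \<noteq> 0" if "q \<in> D" "adm n f (Lf q) K" for q K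
    using cdet_nonzero[OF fr _ _ adm_agree[OF K0[OF that(1)] that(2)]] K0[OF that(1)] that(2)
    by (simp add: adm_def)
  {
    fix q K assume "q \<in> D" "adm n f (Lf q) K"
    from nz[OF this] show "sgn (cdet n f e (Lf q + K0) (Lf q + K)) \<in> {1, -1}" by (auto simp: sgn_real_def)
  next
    fix q K K' assume q: "q \<in> D" and K: "adm n f (Lf q) K"
    show "sgn (cdet n f e (Lf q + K0) (Lf q + K')) =
        sgn (cdet n f e (Lf q + K) (Lf q + K')) * sgn (cdet n f e (Lf q + K0) (Lf q + K))"
      using cdet_mult[OF fr _ _ adm_agree[OF K0[OF q] K], of "Lf q + K'"] K0[OF q] K
      by (simp add: adm_def mult.commute flip: sgn_mult)
  next
    fix K
    have "continuous_on {q \<in> D. adm n f (Lf q) K} Lf" by (rule continuous_on_subset[OF cont]) auto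
    then have "continuous_on {q \<in> D. adm n f (Lf q) K} (\<lambda>q. cdet n f e (Lf q + K0) (Lf q + K))"
      using K0 by (intro continuous_on_cdet continuous_intros) (auto simp: adm_def)
    then show "continuous_on {q \<in> D. adm n f (Lf q) K} (\<lambda>q. sgn (cdet n f e (Lf q + K0) (Lf q + K)))"
      using nz by (intro continuous_on_sgn) auto
  }
qed

text \<open>The two possible values are at distance 2, so continuity leaves no room for a change
  nearby.\<close>

lemma orientation_locally_constant:
  fixes Lf :: "'q::metric_space \<Rightarrow> 'a::banach \<Rightarrow>\<^sub>L 'a"
  assumes w: "orientation n f e Lf D w" and cont: "continuous_on D Lf"
    and r: "r \<in> D" "adm n f (Lf r) K"
  obtains T where "openin (top_of_set D) T" "r \<in> T" "\<And>x. x \<in> T \<Longrightarrow> adm n f (Lf x) K \<and> w x K = w r K"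
proof
  define U where "U = {q \<in> D. adm n f (Lf q) K}"
  define T where "T = U \<inter> (\<lambda>q. w q K) -` ball (w r K) 1"
  have "openin (top_of_set U) T"
    unfolding T_def U_def by (rule continuous_openin_preimage_gen[OF orientationD(3)[OF w] open_ball])
  then show "openin (top_of_set D) T"
    using openin_adm[OF cont] unfolding U_def by (rule openin_trans)
  show "r \<in> T" using r by (simp add: T_def U_def)
  fix x assume "x \<in> T"
  then have x: "x \<in> D" "adm n f (Lf x) K" "\<bar>w r K - w x K\<bar> < 1" by (auto simp: T_def U_def dist_real_def)
  then show "adm n f (Lf x) K \<and> w x K = w r K"
    using orientationD(1)[OF w r] orientationD(1)[OF w x(1,2)] by auto
qed

text \<open>Both orientations pick up the same sign under a change of corrector, so their product
  depends only on \<open>q\<close>; it is locally constant, hence constant on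
  \<open>D\<close>.\<close>

lemma orientation_unique:
  fixes Lf :: "'q::metric_space \<Rightarrow> 'a::banach \<Rightarrow>\<^sub>L 'a"
  assumes fr: "frame n f e" and D: "connected D" and cont: "continuous_on D Lf"
    and ex: "\<And>q. q \<in> D \<Longrightarrow> \<exists>K. adm n f (Lf q) K"
    and w: "orientation n f e Lf D w" and w': "orientation n f e Lf D w'"
  obtains c where "c \<in> {1, -1}" "\<And>q K. q \<in> D \<Longrightarrow> adm n f (Lf q) K \<Longrightarrow> w' q K = c * w q K"
proof (cases "D = {}")
  case True
  then show ?thesis using that[of 1] by simp
next
  case False
  then obtain p where p: "p \<in> D" by auto
  obtain K0 where K0: "adm n f (Lf p) K0" using ex[OF p] by auto
  define c where "c = w p K0 * w' p K0"
  have c: "c \<in> {1, -1}" using orientationD(1)[OF w p K0] orientationD(1)[OF w' p K0] by (auto simp: c_def)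
  have indep: "w q K * w' q K = w q K' * w' q K'"
    if "q \<in> D" "adm n f (Lf q) K" "adm n f (Lf q) K'" for q K K'
  proof -
    have "sgn (cdet n f e (Lf q + K) (Lf q + K')) \<in> {1, -1}"
      using cdet_nonzero[OF fr _ _ adm_agree[OF that(2,3)]] that by (auto simp: adm_def sgn_real_def)
    then show ?thesis
      using orientationD(2)[OF w that] orientationD(2)[OF w' that] by auto
  qed
  define P where "P q \<longleftrightarrow> (\<forall>K. adm n f (Lf q) K \<longrightarrow> w q K * w' q K = c)" for q
  have P: "P q" if "q \<in> D" for q
  proof (rule connected_induction_simple[OF D, of p q P])
    show "P p" unfolding P_def using indep[OF p _ K0] by (simp add: c_def)
    fix r assume r: "r \<in> D"
    obtain K where K: "adm n f (Lf r) K" using ex[OF r] by auto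
    obtain T where T: "openin (top_of_set D) T" "r \<in> T" "\<And>x. x \<in> T \<Longrightarrow> adm n f (Lf x) K \<and> w x K = w r K"
      using orientation_locally_constant[OF w cont r K] by metis
    obtain T' where T': "openin (top_of_set D) T'" "r \<in> T'" "\<And>x. x \<in> T' \<Longrightarrow> adm n f (Lf x) K \<and> w' x K = w' r K"
      using orientation_locally_constant[OF w' cont r K] by metis
    have TD: "x \<in> D" if "x \<in> T" for x using T(1) that openin_imp_subset by blast
    have "P y" if "x \<in> T \<inter> T'" "y \<in> T \<inter> T'" "P x" for x y
    proof -
      have "w y K * w' y K = c" using that T(3) T'(3) unfolding P_def by (metis IntD1 IntD2)
      then show ?thesis unfolding P_def using indep[of y _ K] T(3) TD that(2) by (metis IntD1)
    qed
    then show "\<exists>T. openin (top_of_set D) T \<and> r \<in> T \<and> (\<forall>x\<in>T. \<forall>y\<in>T. P x \<longrightarrow> P y)"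
      using T T' openin_Int[OF T(1) T'(1)] by blast
  qed (use p that in auto)
  have "w' q K = c * w q K" if "q \<in> D" "adm n f (Lf q) K" for q K
    using P[OF that(1)] that orientationD(1)[OF w that] unfolding P_def by auto
  then show ?thesis using that[of c] c by blast
qed

text \<open>On the interface the two orientations differ by one sign, since the interface is
  connected; multiplying \<open>w'\<close> by it makes them match. A disconnected interface could
  leave a monodromy.\<close>

lemma orientation_glue:
  fixes Lf :: "'q::metric_space \<Rightarrow> 'a::banach \<Rightarrow>\<^sub>L 'a" and h :: "'q \<Rightarrow> real"
  assumes fr: "frame n f e" and cont: "continuous_on D Lf" and h: "continuous_on D h"
    and ex: "\<And>q. q \<in> D \<Longrightarrow> \<exists>K. adm n f (Lf q) K"
    and conn: "connected {q \<in> D. h q = a}"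
    and w: "orientation n f e Lf {q \<in> D. h q \<le> a} w" and w': "orientation n f e Lf {q \<in> D. a \<le> h q} w'"
  shows "\<exists>v. orientation n f e Lf D v"
proof -
  have wE: "orientation n f e Lf {q \<in> D. h q = a} w"
    using orientation_reparam[OF w continuous_on_id, of "{q \<in> D. h q = a}"] by auto
  have w'E: "orientation n f e Lf {q \<in> D. h q = a} w'"
    using orientation_reparam[OF w' continuous_on_id, of "{q \<in> D. h q = a}"] by auto
  have contE: "continuous_on {q \<in> D. h q = a} Lf" by (rule continuous_on_subset[OF cont]) auto
  have exE: "\<exists>K. adm n f (Lf q) K" if "q \<in> {q \<in> D. h q = a}" for q using ex that by auto
  obtain c where c: "c \<in> {1, -1}"
    and eq: "\<And>q K. q \<in> {q \<in> D. h q = a} \<Longrightarrow> adm n f (Lf q) K \<Longrightarrow> w q K = c * w' q K"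
    using orientation_unique[OF fr conn contE exE w'E wE] by blast
  define u where "u q K = c * w' q K" for q K
  have u: "orientation n f e Lf {q \<in> D. a \<le> h q} u"
    unfolding u_def by (rule orientation_scale[OF w' c])
  define v where "v q K = (if h q \<le> a then w q K else u q K)" for q K
  have "orientation n f e Lf D v"
    unfolding orientation_def
  proof (intro conjI ballI allI impI)
    fix q K assume "q \<in> D" "adm n f (Lf q) K"
    then show "v q K \<in> {1, -1}"
      using orientationD(1)[OF w, of q K] orientationD(1)[OF u, of q K] by (auto simp: v_def)
  next
    fix q K K' assume "q \<in> D" "adm n f (Lf q) K" "adm n f (Lf q) K'"
    then show "v q K' = sgn (cdet n f e (Lf q + K) (Lf q + K')) * v q K"
      using orientationD(2)[OF w, of q K K'] orientationD(2)[OF u, of q K K'] by (auto simp: v_def)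
  next
    fix K
    define S where "S = {q \<in> D. adm n f (Lf q) K}"
    have "continuous_on {q \<in> S. h q \<le> a} (\<lambda>q. w q K)"
      by (rule continuous_on_subset[OF orientationD(3)[OF w, of K]]) (auto simp: S_def)
    moreover have "continuous_on {q \<in> S. a \<le> h q} (\<lambda>q. u q K)"
      by (rule continuous_on_subset[OF orientationD(3)[OF u, of K]]) (auto simp: S_def)
    moreover have "continuous_on S h" by (rule continuous_on_subset[OF h]) (auto simp: S_def)
    moreover have "w q K = u q K" if "q \<in> S" "h q = a" for q
      using eq that by (auto simp: S_def u_def)
    ultimately show "continuous_on {q \<in> D. adm n f (Lf q) K} (\<lambda>q. v q K)"
      unfolding v_def S_def[symmetric] by (rule continuous_on_cases_le)
  qed
  then show ?thesis by blast
qed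

text \<open>A rectangle has no monodromy. Concretely, one corrector serves each small box, boxes are
  glued to horizontal strips, and strips to the rectangle, by bisection in each coordinate; all
  interfaces are segments and hence connected.\<close>

lemma orientation_rectangle:
  fixes Lf :: "real \<times> real \<Rightarrow> 'a::banach \<Rightarrow>\<^sub>L 'a"
  assumes fr: "frame n f e" and cont: "continuous_on UNIV Lf" and le: "a' \<le> b'" "a \<le> b"
    and ex: "\<And>q. q \<in> {a'..b'} \<times> {a..b} \<Longrightarrow> \<exists>K. adm n f (Lf q) K"
  shows "\<exists>w. orientation n f e Lf ({a'..b'} \<times> {a..b}) w"
proof -
  define D where "D = {a'..b'} \<times> {a..b}"
  define R where "R s t l m = D \<inter> ({s..t} \<times> {l..m})" for s t l m
  define Or where "Or s t l m \<longleftrightarrow> (\<exists>w. orientation n f e Lf (R s t l m) w)" for s t l m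
  have contR: "continuous_on X Lf" for X using cont continuous_on_subset by blast
  have exR: "\<exists>K. adm n f (Lf q) K" if "q \<in> R s t l m" for q s t l m
    using ex that by (auto simp: R_def D_def)
  have convR: "connected (R s t l m)" for s t l m
    unfolding R_def D_def by (intro convex_connected convex_Int convex_Times) auto
  have glue_fst: "Or s t l m" if Or2: "Or s r l m" "Or r t l m" and le2: "s \<le> r" "r \<le> t" for s r t l m
  proof -
    have eq: "{q \<in> R s t l m. fst q \<le> r} = R s r l m" "{q \<in> R s t l m. r \<le> fst q} = R r t l m"
      "{q \<in> R s t l m. fst q = r} = R r r l m" using le2 by (auto simp: R_def)
    obtain w w' where w: "orientation n f e Lf (R s r l m) w" "orientation n f e Lf (R r t l m) w'"
      using Or2 unfolding Or_def by blast
    show ?thesis unfolding Or_def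
      by (rule orientation_glue[where D = "R s t l m" and h = fst and a = r and w = w and w' = w', unfolded eq,
            OF fr contR continuous_on_fst[OF continuous_on_id] exR convR w])
  qed
  have glue_snd: "Or s t l m" if Or2: "Or s t l r" "Or s t r m" and le2: "l \<le> r" "r \<le> m" for s r t l m
  proof -
    have eq: "{q \<in> R s t l m. snd q \<le> r} = R s t l r" "{q \<in> R s t l m. r \<le> snd q} = R s t r m"
      "{q \<in> R s t l m. snd q = r} = R s t r r" using le2 by (auto simp: R_def)
    obtain w w' where w: "orientation n f e Lf (R s t l r) w" "orientation n f e Lf (R s t r m) w'"
      using Or2 unfolding Or_def by blast
    show ?thesis unfolding Or_def
      by (rule orientation_glue[where D = "R s t l m" and h = snd and a = r and w = w and w' = w', unfolded eq,
            OF fr contR continuous_on_snd[OF continuous_on_id] exR convR w])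
  qed
  have small: "\<exists>d>0. \<forall>s t l m. s \<le> x \<and> x \<le> t \<and> t - s < d \<and> l \<le> y \<and> y \<le> m \<and> m - l < d \<longrightarrow> Or s t l m"
    if xy: "(x, y) \<in> D" for x y
  proof -
    obtain K where K: "adm n f (Lf (x, y)) K" using ex[of "(x, y)"] xy unfolding D_def by blast
    have "open {q. adm n f (Lf q) K}" using openin_adm[OF cont] by simp
    then obtain d where d: "d > 0" "\<And>q. dist q (x, y) < d \<Longrightarrow> adm n f (Lf q) K"
      using K unfolding open_dist by blast
    have "Or s t l m" if "s \<le> x" "x \<le> t" "t - s < d / 2" "l \<le> y" "y \<le> m" "m - l < d / 2" for s t l m
    proof -
      have "adm n f (Lf q) K" if "q \<in> R s t l m" for q
      proof (rule d(2))
        obtain u v where q: "q = (u, v)" by (cases q)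
        have "dist q (x, y) \<le> \<bar>u - x\<bar> + \<bar>v - y\<bar>"
          unfolding q dist_Pair_Pair dist_real_def using sqrt_sum_squares_le_sum_abs[of "\<bar>u - x\<bar>" "\<bar>v - y\<bar>"] by simp
        also have "\<dots> < d" using that \<open>s \<le> x\<close> \<open>x \<le> t\<close> \<open>t - s < d / 2\<close> \<open>l \<le> y\<close> \<open>y \<le> m\<close> \<open>m - l < d / 2\<close>
          by (auto simp: q R_def)
        finally show "dist q (x, y) < d" .
      qed
      then show ?thesis unfolding Or_def using orientation_const[OF fr contR] by blast
    qed
    then show ?thesis using d(1) by (intro exI[where x = "d / 2"]) auto
  qed
  \<comment> \<open>The bisection runs over the first coordinate with \<open>y\<close> fixed; the
    height \<open>d\<close> of the strip shrinks to the smaller of two heights at each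
    gluing.\<close>
  have strip: "\<exists>d>0. \<forall>l m. l \<le> y \<and> y \<le> m \<and> m - l < d \<longrightarrow> Or a' b' l m" if y: "a \<le> y" "y \<le> b" for y
    using le(1)
  proof (induction a' b' rule: Bolzano)
    case (trans s r t)
    then obtain d d' where d: "d > 0" "\<And>l m. l \<le> y \<and> y \<le> m \<and> m - l < d \<Longrightarrow> Or s r l m"
      and d': "d' > 0" "\<And>l m. l \<le> y \<and> y \<le> m \<and> m - l < d' \<Longrightarrow> Or r t l m" by blast
    then have "Or s t l m" if "l \<le> y" "y \<le> m" "m - l < min d d'" for l m
      using that trans(3,4) by (intro glue_fst[of s r l m t]) auto
    then show ?case using d(1) d'(1) by (intro exI[where x = "min d d'"]) auto
  next
    case (local x)
    then have "(x, y) \<in> D" using y by (simp add: D_def)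
    from small[OF this] show ?case by blast
  qed
  have "Or a' b' a b"
    using le(2)
  proof (induction a b rule: Bolzano)
    case (trans l r m)
    then show ?case by (rule glue_snd)
  next
    case (local y)
    from strip[OF local] show ?case by blast
  qed
  moreover have "R a' b' a b = D" by (simp add: R_def D_def)
  ultimately show ?thesis unfolding Or_def D_def by simp
qed

section \<open>Parity of a pencil along an interval\<close>

text \<open>The parity of Fitzpatrick and Pejsachowicz: an orientation is transported from
  \<open>a\<close> to \<open>b\<close> and read off at the canonical corrector 0 at both ends. An
  orientation is unique up to a global sign, which cancels in the product, so the choice made by
  \<open>SOME\<close> does not matter when the ends are invertible and correctors exist
  throughout.\<close>

definition par :: "nat \<Rightarrow> (nat \<Rightarrow> 'a::real_normed_vector \<Rightarrow>\<^sub>L real) \<Rightarrow> (nat \<Rightarrow> 'a) \<Rightarrow>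
    ('a \<Rightarrow>\<^sub>L 'a) \<Rightarrow> real \<Rightarrow> real \<Rightarrow> real" where
  "par n f e T a b =
     (SOME \<sigma>. \<exists>w. orientation n f e (\<lambda>l. T - l *\<^sub>R id_blinfun) {a..b} w \<and> \<sigma> = w a 0 * w b 0)"

lemma par_eqI:
  fixes T :: "'a::banach \<Rightarrow>\<^sub>L 'a"
  assumes fr: "frame n f e" and le: "a \<le> b"
    and w: "orientation n f e (\<lambda>l. T - l *\<^sub>R id_blinfun) {a..b} w"
    and ex: "\<And>l. l \<in> {a..b} \<Longrightarrow> \<exists>K. adm n f (T - l *\<^sub>R id_blinfun) K"
    and GL: "T - a *\<^sub>R id_blinfun \<in> GL" "T - b *\<^sub>R id_blinfun \<in> GL"
  shows "par n f e T a b = w a 0 * w b 0"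
proof -
  have "\<exists>w'. orientation n f e (\<lambda>l. T - l *\<^sub>R id_blinfun) {a..b} w' \<and> par n f e T a b = w' a 0 * w' b 0"
    unfolding par_def by (rule someI_ex) (use w in blast)
  then obtain w' where w': "orientation n f e (\<lambda>l. T - l *\<^sub>R id_blinfun) {a..b} w'"
    and eq: "par n f e T a b = w' a 0 * w' b 0" by blast
  have cont: "continuous_on {a..b} (\<lambda>l. T - l *\<^sub>R id_blinfun)" by (intro continuous_intros)
  have conn: "connected {a..b}" by simp
  obtain c where c: "c \<in> {1, -1}"
    and cw: "\<And>q K. q \<in> {a..b} \<Longrightarrow> adm n f (T - q *\<^sub>R id_blinfun) K \<Longrightarrow> w' q K = c * w q K"
    using orientation_unique[OF fr conn cont ex w w'] by blast
  have "w' a 0 = c * w a 0" "w' b 0 = c * w b 0" using cw[of a 0] cw[of b 0] le GL by (simp_all add: adm_zero)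
  then show ?thesis using c eq by auto
qed

definition bounded_below_on :: "nat \<Rightarrow> (nat \<Rightarrow> 'a::real_normed_vector \<Rightarrow>\<^sub>L real) \<Rightarrow> real \<Rightarrow> ('a \<Rightarrow>\<^sub>L 'a) \<Rightarrow> bool" where
  "bounded_below_on n f c L \<longleftrightarrow> 0 < c \<and> (\<forall>x\<in>fkernel n f. c * norm x \<le> norm (blinfun_apply L x))"

text \<open>Invertibility at the single corner (0, \<open>a\<close>) suffices: the lower bound
  spreads correctors from there over the connected rectangle, and a rectangle with correctors
  everywhere is orientable.\<close>

lemma segment_orientation:
  fixes S T :: "'a::banach \<Rightarrow>\<^sub>L 'a"
  assumes fr: "frame n f e" and le: "a \<le> b"
    and below: "\<And>s l. s \<in> {0..1} \<Longrightarrow> l \<in> {a..b} \<Longrightarrow> bounded_below_on n f c (S + s *\<^sub>R (T - S) - l *\<^sub>R id_blinfun)"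
    and GL: "S - a *\<^sub>R id_blinfun \<in> GL"
  obtains w where "orientation n f e (\<lambda>(s, l). S + s *\<^sub>R (T - S) - l *\<^sub>R id_blinfun) ({0..1} \<times> {a..b}) w"
    and "\<And>s l. s \<in> {0..1} \<Longrightarrow> l \<in> {a..b} \<Longrightarrow> \<exists>K. adm n f (S + s *\<^sub>R (T - S) - l *\<^sub>R id_blinfun) K"
proof -
  define Lf where "Lf = (\<lambda>(s, l). S + s *\<^sub>R (T - S) - l *\<^sub>R id_blinfun)"
  define D where "D = {0..1::real} \<times> {a..b}"
  have cont: "continuous_on X Lf" for X unfolding Lf_def split_beta by (intro continuous_intros)
  have D: "connected D" unfolding D_def by (intro convex_connected convex_Times) auto
  have c: "0 < c" using below[of 0 a] le by (simp add: bounded_below_on_def)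
  have below': "c * norm x \<le> norm (blinfun_apply (Lf q) x)" if "q \<in> D" "x \<in> fkernel n f" for q x
    using below[of "fst q" "snd q"] that by (auto simp: D_def Lf_def bounded_below_on_def)
  have "adm n f (Lf (0, a)) 0" using GL by (simp add: adm_zero Lf_def)
  moreover have "(0, a) \<in> D" using le by (simp add: D_def)
  ultimately have ex: "\<exists>K. adm n f (Lf q) K" if "q \<in> D" for q
    using adm_connected[OF fr D cont c below' _ _ that, of "(0, a)"] by blast
  then obtain w where "orientation n f e Lf D w"
    using orientation_rectangle[OF fr cont _ le, of 0 1] unfolding D_def by auto
  then show thesis using that[of w] ex unfolding D_def Lf_def by auto
qed

lemma path_orientation:
  fixes T :: "'a::banach \<Rightarrow>\<^sub>L 'a"
  assumes fr: "frame n f e" and le: "a \<le> b"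
    and below: "\<And>l. l \<in> {a..b} \<Longrightarrow> bounded_below_on n f c (T - l *\<^sub>R id_blinfun)"
    and GL: "T - a *\<^sub>R id_blinfun \<in> GL"
  obtains w where "orientation n f e (\<lambda>l. T - l *\<^sub>R id_blinfun) {a..b} w"
    and "\<And>l. l \<in> {a..b} \<Longrightarrow> \<exists>K. adm n f (T - l *\<^sub>R id_blinfun) K"
proof -
  obtain w where w: "orientation n f e (\<lambda>(s, l). T + s *\<^sub>R (T - T) - l *\<^sub>R id_blinfun) ({0..1} \<times> {a..b}) w"
    and ex: "\<And>s l. s \<in> {0..1} \<Longrightarrow> l \<in> {a..b} \<Longrightarrow> \<exists>K. adm n f (T + s *\<^sub>R (T - T) - l *\<^sub>R id_blinfun) K"
    using segment_orientation[OF fr le, of c T T] below GL by auto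
  have "orientation n f e (\<lambda>l. T - l *\<^sub>R id_blinfun) {a..b} (\<lambda>l. w (0, l))"
    using orientation_reparam[OF w continuous_on_Pair[OF continuous_on_const continuous_on_id, of "{a..b}" 0]] by force
  then show thesis using that ex[of 0] by simp
qed

lemma par_pm1:
  fixes T :: "'a::banach \<Rightarrow>\<^sub>L 'a"
  assumes fr: "frame n f e" and le: "a \<le> b"
    and below: "\<And>l. l \<in> {a..b} \<Longrightarrow> bounded_below_on n f c (T - l *\<^sub>R id_blinfun)"
    and GL: "T - a *\<^sub>R id_blinfun \<in> GL" "T - b *\<^sub>R id_blinfun \<in> GL"
  shows "par n f e T a b \<in> {1, -1}"
proof -
  obtain w where w: "orientation n f e (\<lambda>l. T - l *\<^sub>R id_blinfun) {a..b} w"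
    and ex: "\<And>l. l \<in> {a..b} \<Longrightarrow> \<exists>K. adm n f (T - l *\<^sub>R id_blinfun) K"
    using path_orientation[OF fr le below GL(1)] by blast
  have "w a 0 \<in> {1, -1}" "w b 0 \<in> {1, -1}" using orientationD(1)[OF w] le GL by (simp_all add: adm_zero)
  then show ?thesis using par_eqI[OF fr le w ex GL] by auto
qed

text \<open>One orientation of the whole interval serves both halves; its value at \<open>b\<close>
  occurs twice and squares to 1.\<close>

lemma par_split:
  fixes T :: "'a::banach \<Rightarrow>\<^sub>L 'a"
  assumes fr: "frame n f e" and le: "a \<le> b" "b \<le> d"
    and below: "\<And>l. l \<in> {a..d} \<Longrightarrow> bounded_below_on n f c (T - l *\<^sub>R id_blinfun)"
    and GL: "T - a *\<^sub>R id_blinfun \<in> GL" "T - b *\<^sub>R id_blinfun \<in> GL" "T - d *\<^sub>R id_blinfun \<in> GL"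
  shows "par n f e T a d = par n f e T a b * par n f e T b d"
proof -
  have ad: "a \<le> d" using le by simp
  obtain w where w: "orientation n f e (\<lambda>l. T - l *\<^sub>R id_blinfun) {a..d} w"
    and ex: "\<And>l. l \<in> {a..d} \<Longrightarrow> \<exists>K. adm n f (T - l *\<^sub>R id_blinfun) K"
    using path_orientation[OF fr ad below GL(1)] by blast
  have sub: "orientation n f e (\<lambda>l. T - l *\<^sub>R id_blinfun) X w" if "X \<subseteq> {a..d}" for X
    using orientation_reparam[OF w, of X "\<lambda>l. l"] that by auto
  have "par n f e T a d = w a 0 * w d 0" by (rule par_eqI[OF fr ad w ex GL(1,3)])
  moreover have "par n f e T a b = w a 0 * w b 0"
    by (rule par_eqI[OF fr le(1) sub ex GL(1,2)]) (use le in auto)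
  moreover have "par n f e T b d = w b 0 * w d 0"
    by (rule par_eqI[OF fr le(2) sub ex GL(2,3)]) (use le in auto)
  moreover have "w b 0 \<in> {1, -1}" using orientationD(1)[OF w] le GL by (simp_all add: adm_zero)
  ultimately show ?thesis by auto
qed

text \<open>The rectangle carries an orientation, and on the two sides over \<open>a\<close> and
  \<open>b\<close> the corrector 0 is admissible throughout. There the orientation is continuous
  with values in {1, -1}, so its end values do not change with \<open>s\<close>.\<close>

lemma par_homotopy:
  fixes S T :: "'a::banach \<Rightarrow>\<^sub>L 'a"
  assumes fr: "frame n f e" and le: "a \<le> b"
    and below: "\<And>s l. s \<in> {0..1} \<Longrightarrow> l \<in> {a..b} \<Longrightarrow> bounded_below_on n f c (S + s *\<^sub>R (T - S) - l *\<^sub>R id_blinfun)"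
    and GLa: "\<And>s. s \<in> {0..1} \<Longrightarrow> S + s *\<^sub>R (T - S) - a *\<^sub>R id_blinfun \<in> GL"
    and GLb: "\<And>s. s \<in> {0..1} \<Longrightarrow> S + s *\<^sub>R (T - S) - b *\<^sub>R id_blinfun \<in> GL"
  shows "par n f e S a b = par n f e T a b"
proof -
  obtain w where w: "orientation n f e (\<lambda>(s, l). S + s *\<^sub>R (T - S) - l *\<^sub>R id_blinfun) ({0..1} \<times> {a..b}) w"
    and ex: "\<And>s l. s \<in> {0..1} \<Longrightarrow> l \<in> {a..b} \<Longrightarrow> \<exists>K. adm n f (S + s *\<^sub>R (T - S) - l *\<^sub>R id_blinfun) K"
    using segment_orientation[OF fr le below] GLa[of 0] by auto
  have slice: "orientation n f e (\<lambda>l. S + s *\<^sub>R (T - S) - l *\<^sub>R id_blinfun) {a..b} (\<lambda>l. w (s, l))"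
    if "s \<in> {0..1}" for s
    using orientation_reparam[OF w continuous_on_Pair[OF continuous_on_const continuous_on_id, of "{a..b}" s]] that by force
  have side: "w (0, l) 0 = w (1, l) 0"
    if l: "l \<in> {a..b}" and GL: "\<And>s. s \<in> {0..1} \<Longrightarrow> S + s *\<^sub>R (T - S) - l *\<^sub>R id_blinfun \<in> GL" for l
  proof -
    have v: "orientation n f e (\<lambda>s. S + s *\<^sub>R (T - S) - l *\<^sub>R id_blinfun) {0..1} (\<lambda>s. w (s, l))"
      using orientation_reparam[OF w continuous_on_Pair[OF continuous_on_id continuous_on_const, of "{0..1}" l]] l by force
    have dom: "{s \<in> {0..1}. adm n f (S + s *\<^sub>R (T - S) - l *\<^sub>R id_blinfun) 0} = {0..1}"
      using GL by (auto simp: adm_zero)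
    have "(\<lambda>s. w (s, l) 0) constant_on {0..1::real}"
    proof (rule continuous_finite_range_constant)
      show "continuous_on {0..1} (\<lambda>s. w (s, l) 0)" using orientationD(3)[OF v, of 0] dom by simp
      have "(\<lambda>s. w (s, l) 0) ` {0..1} \<subseteq> {1, -1}"
        using orientationD(1)[OF v, of _ 0] GL unfolding adm_zero by blast
      then show "finite ((\<lambda>s. w (s, l) 0) ` {0..1})" by (rule finite_subset) simp
    qed simp
    then obtain k where "\<And>s. s \<in> {0..1} \<Longrightarrow> w (s, l) 0 = k" unfolding constant_on_def by blast
    then show ?thesis by simp
  qed
  have "par n f e S a b = w (0, a) 0 * w (0, b) 0"
    by (rule par_eqI[OF fr le]) (use slice[of 0] ex[of 0] GLa[of 0] GLb[of 0] in simp_all)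
  moreover have "par n f e T a b = w (1, a) 0 * w (1, b) 0"
    by (rule par_eqI[OF fr le]) (use slice[of 1] ex[of 1] GLa[of 1] GLb[of 1] in simp_all)
  ultimately show ?thesis using side[of a] side[of b] le GLa GLb by simp
qed

lemma adm_uminus: "adm n f (- L) K \<longleftrightarrow> adm n f L (- K)"
  using GL_uminus[of "L - K"] GL_uminus[of "K - L"] by (auto simp: adm_def blinfun.bilinear_simps)

lemma cdet_uminus: "G \<in> GL \<Longrightarrow> cdet n f e (- G) (- H) = cdet n f e G H"
  by (simp add: cdet_def binv_uminus blinfun.bilinear_simps)

text \<open>Negating two operators leaves their relative determinant unchanged for every
  \<open>n\<close>, since the sign of the inverse cancels the other one. An orientation is thus
  carried over by l \<mapsto> - l and K \<mapsto> - K, and the corrector 0 goes to itself.\<close>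

lemma par_uminus:
  fixes T :: "'a::banach \<Rightarrow>\<^sub>L 'a"
  assumes fr: "frame n f e" and le: "a \<le> b"
    and below: "\<And>l. l \<in> {a..b} \<Longrightarrow> bounded_below_on n f c (T - l *\<^sub>R id_blinfun)"
    and GL: "T - a *\<^sub>R id_blinfun \<in> GL" "T - b *\<^sub>R id_blinfun \<in> GL"
  shows "par n f e (- T) (- b) (- a) = par n f e T a b"
proof -
  obtain w where w: "orientation n f e (\<lambda>l. T - l *\<^sub>R id_blinfun) {a..b} w"
    and ex: "\<And>l. l \<in> {a..b} \<Longrightarrow> \<exists>K. adm n f (T - l *\<^sub>R id_blinfun) K"
    using path_orientation[OF fr le below GL(1)] by blast
  have neg: "- T - l *\<^sub>R id_blinfun = - (T - (- l) *\<^sub>R id_blinfun)" for l by simp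
  define v where "v l K = w (- l) (- K)" for l K
  have v: "orientation n f e (\<lambda>l. - T - l *\<^sub>R id_blinfun) {- b..- a} v"
    unfolding orientation_def v_def
  proof (intro conjI ballI allI impI)
    fix l K assume "l \<in> {- b..- a}" "adm n f (- T - l *\<^sub>R id_blinfun) K"
    then show "w (- l) (- K) \<in> {1, -1}"
      using orientationD(1)[OF w, of "- l" "- K"] unfolding neg adm_uminus by auto
  next
    fix l K K' assume l: "l \<in> {- b..- a}" and K: "adm n f (- T - l *\<^sub>R id_blinfun) K"
      and K': "adm n f (- T - l *\<^sub>R id_blinfun) K'"
    have "cdet n f e (- T - l *\<^sub>R id_blinfun + K) (- T - l *\<^sub>R id_blinfun + K') =
        cdet n f e (- (T - (- l) *\<^sub>R id_blinfun + - K)) (- (T - (- l) *\<^sub>R id_blinfun + - K'))"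
      by (rule arg_cong2[where f = "cdet n f e"]) (simp_all add: algebra_simps)
    also have "\<dots> = cdet n f e (T - (- l) *\<^sub>R id_blinfun + - K) (T - (- l) *\<^sub>R id_blinfun + - K')"
      using K unfolding neg adm_uminus by (intro cdet_uminus) (simp add: adm_def)
    finally show "w (- l) (- K') = sgn (cdet n f e (- T - l *\<^sub>R id_blinfun + K) (- T - l *\<^sub>R id_blinfun + K')) * w (- l) (- K)"
      using orientationD(2)[OF w, of "- l" "- K" "- K'"] l K K' unfolding neg adm_uminus by auto
  next
    fix K
    show "continuous_on {l \<in> {- b..- a}. adm n f (- T - l *\<^sub>R id_blinfun) K} (\<lambda>l. w (- l) (- K))"
      unfolding neg adm_uminus
      by (rule continuous_on_compose2[OF orientationD(3)[OF w, of "- K"] continuous_on_minus[OF continuous_on_id]]) auto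
  qed
  have "\<exists>K. adm n f (- T - l *\<^sub>R id_blinfun) K" if l: "l \<in> {- b..- a}" for l
  proof -
    obtain K where "adm n f (T - (- l) *\<^sub>R id_blinfun) K" using ex[of "- l"] l by auto
    then have "adm n f (- (T - (- l) *\<^sub>R id_blinfun)) (- K)" unfolding adm_uminus by simp
    then show ?thesis unfolding neg by blast
  qed
  moreover have "- T - (- b) *\<^sub>R id_blinfun \<in> GL" "- T - (- a) *\<^sub>R id_blinfun \<in> GL"
    using GL_uminus[OF GL(1)] GL_uminus[OF GL(2)] by simp_all
  ultimately have "par n f e (- T) (- b) (- a) = v (- b) 0 * v (- a) 0"
    using le by (intro par_eqI[OF fr _ v]) auto
  also have "\<dots> = par n f e T a b" using par_eqI[OF fr le w ex GL] by (simp add: v_def mult.commute)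
  finally show ?thesis .
qed

text \<open>The corrector 0 trivializes the whole interval, and relative to itself it has sign 1 at
  both ends.\<close>

lemma par_GL:
  fixes T :: "'a::banach \<Rightarrow>\<^sub>L 'a"
  assumes fr: "frame n f e" and le: "a \<le> b" and GL: "\<And>l. l \<in> {a..b} \<Longrightarrow> T - l *\<^sub>R id_blinfun \<in> GL"
  shows "par n f e T a b = 1"
proof -
  have adm: "\<And>l. l \<in> {a..b} \<Longrightarrow> adm n f (T - l *\<^sub>R id_blinfun) 0" using GL by (simp add: adm_zero)
  have "continuous_on {a..b} (\<lambda>l. T - l *\<^sub>R id_blinfun)" by (intro continuous_intros)
  from par_eqI[OF fr le orientation_const[OF fr this adm]] show ?thesis
    using adm GL le cdet_refl[OF fr] by auto
qed

section \<open>Parity on HI spaces\<close>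

lemma GL_upper_fredholm:
  assumes "G \<in> GL"
  shows "upper_fredholm G"
  unfolding upper_fredholm_def
proof (intro exI[where x = "{}"] exI[where x = "1 / (norm (binv G) + 1)"] conjI ballI)
  show "0 < 1 / (norm (binv G) + 1)" by (simp add: add_nonneg_pos)
  fix x
  have "norm x \<le> (norm (binv G) + 1) * norm (blinfun_apply G x)"
    using assms by (rule GL_bounded_below) simp
  then show "1 / (norm (binv G) + 1) * norm x \<le> norm (blinfun_apply G x)"
    by (simp add: pos_divide_le_eq add_nonneg_pos mult.commute)
qed simp

lemma bounded_below_perturb:
  assumes "c * norm x \<le> norm (blinfun_apply L x)" "norm (L' - L) \<le> c / 2"
  shows "c / 2 * norm x \<le> norm (blinfun_apply L' x)"
proof -
  have "norm (blinfun_apply (L' - L) x) \<le> c / 2 * norm x"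
    using norm_blinfun[of "L' - L" x] mult_right_mono[OF assms(2), of "norm x"] by simp
  moreover have "norm (blinfun_apply L x) \<le> norm (blinfun_apply L' x) + norm (blinfun_apply (L' - L) x)"
    using norm_triangle_ineq4[of "blinfun_apply L' x" "blinfun_apply (L' - L) x"]
    by (simp add: blinfun.bilinear_simps)
  ultimately show ?thesis using assms(1) by simp
qed

text \<open>Near each operator its own functionals and half of its own constant work; a finite
  subcover permits the union of the functionals and the minimum of the constants.\<close>

lemma compact_upper_fredholm:
  fixes \<K> :: "('a::real_normed_vector \<Rightarrow>\<^sub>L 'a) set"
  assumes "compact \<K>" and uf: "\<And>L. L \<in> \<K> \<Longrightarrow> upper_fredholm L"
  obtains F c where "finite F" "0 < c" "\<And>L x. L \<in> \<K> \<Longrightarrow> x \<in> ann F \<Longrightarrow> c * norm x \<le> norm (blinfun_apply L x)"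
proof -
  have "\<forall>L\<in>\<K>. \<exists>F c. finite F \<and> 0 < c \<and> (\<forall>x\<in>ann F. c * norm x \<le> norm (blinfun_apply L x))"
    using uf unfolding upper_fredholm_def by blast
  then obtain Fs cs where Fc: "\<And>L. L \<in> \<K> \<Longrightarrow> finite (Fs L)" "\<And>L. L \<in> \<K> \<Longrightarrow> 0 < cs L"
    "\<And>L x. L \<in> \<K> \<Longrightarrow> x \<in> ann (Fs L) \<Longrightarrow> cs L * norm x \<le> norm (blinfun_apply L x)" by metis
  have "\<K> \<subseteq> (\<Union>L\<in>\<K>. ball L (cs L / 2))" using Fc(2) by force
  then obtain C where C: "C \<subseteq> \<K>" "finite C" "\<K> \<subseteq> (\<Union>L\<in>C. ball L (cs L / 2))"
    using compactE_image[OF \<open>compact \<K>\<close>, of \<K> "\<lambda>L. ball L (cs L / 2)"] by auto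
  \<comment> \<open>The inserted 1 keeps the minimum defined when the cover is empty.\<close>
  define c where "c = Min (insert 1 ((\<lambda>L. cs L / 2) ` C))"
  show thesis
  proof
    show "finite (\<Union>L\<in>C. Fs L)" using C Fc(1) by auto
    show "0 < c" unfolding c_def using C Fc(2) by (subst Min_gr_iff) auto
    fix L x assume L: "L \<in> \<K>" and x: "x \<in> ann (\<Union>L\<in>C. Fs L)"
    then obtain L0 where L0: "L0 \<in> C" "dist L0 L < cs L0 / 2" using C(3) by auto
    have "x \<in> ann (Fs L0)" using x L0(1) by (auto simp: ann_def)
    then have "cs L0 * norm x \<le> norm (blinfun_apply L0 x)" using Fc(3) L0(1) C(1) by auto
    then have "cs L0 / 2 * norm x \<le> norm (blinfun_apply L x)"
      by (rule bounded_below_perturb) (use L0(2) in \<open>simp add: dist_norm norm_minus_commute\<close>)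
    moreover have "c \<le> cs L0 / 2" unfolding c_def using C(2) L0(1) by (intro Min_le) auto
    ultimately show "c * norm x \<le> norm (blinfun_apply L x)"
      using mult_right_mono[of c "cs L0 / 2" "norm x"] by simp
  qed
qed

section \<open>Comparison for sufficiently fine frames\<close>

text \<open>Eventual validity as the kernel of the frame shrinks, a filter in substance. Each
  comparison of parities demands its own finite set of functionals, and finite conjunctions merge
  these demands.\<close>

definition eventually_frames ::
  "(nat \<Rightarrow> (nat \<Rightarrow> 'a::real_normed_vector \<Rightarrow>\<^sub>L real) \<Rightarrow> (nat \<Rightarrow> 'a) \<Rightarrow> bool) \<Rightarrow> bool" where
  "eventually_frames P \<longleftrightarrow>
     (\<exists>F. finite F \<and> (\<forall>n f e. frame n f e \<longrightarrow> fkernel n f \<subseteq> ann F \<longrightarrow> P n f e))"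

lemma eventually_frames_conj:
  assumes "eventually_frames P" "eventually_frames Q"
  shows "eventually_frames (\<lambda>n f e. P n f e \<and> Q n f e)"
proof -
  obtain F G where F: "finite F" "\<And>n f e. frame n f e \<Longrightarrow> fkernel n f \<subseteq> ann F \<Longrightarrow> P n f e"
    and G: "finite G" "\<And>n f e. frame n f e \<Longrightarrow> fkernel n f \<subseteq> ann G \<Longrightarrow> Q n f e"
    using assms unfolding eventually_frames_def by blast
  then have "\<forall>n f e. frame n f e \<longrightarrow> fkernel n f \<subseteq> ann (F \<union> G) \<longrightarrow> P n f e \<and> Q n f e"
    by (simp add: ann_Un)
  then show ?thesis unfolding eventually_frames_def using F(1) G(1) finite_UnI by blast
qed

lemma eventually_frames_mono:
  assumes "eventually_frames P" "\<And>n f e. P n f e \<Longrightarrow> Q n f e"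
  shows "eventually_frames Q"
  using assms unfolding eventually_frames_def by blast

text \<open>The conjunct \<open>frame n f e\<close> is carried inside the predicate so that
  monotonicity can pass it on to the parity lemmas, all of which assume it.\<close>

lemma eventually_frames_bounded_below:
  fixes \<K> :: "('a::real_normed_vector \<Rightarrow>\<^sub>L 'a) set"
  assumes "compact \<K>" "\<And>L. L \<in> \<K> \<Longrightarrow> upper_fredholm L"
  shows "\<exists>c. eventually_frames (\<lambda>n f e. frame n f e \<and> (\<forall>L\<in>\<K>. bounded_below_on n f c L))"
proof -
  obtain F c where F: "finite F" "0 < c"
    "\<And>L x. L \<in> \<K> \<Longrightarrow> x \<in> ann F \<Longrightarrow> c * norm x \<le> norm (blinfun_apply L x)"
    using compact_upper_fredholm[OF assms] by blast
  have "eventually_frames (\<lambda>n f e. frame n f e \<and> (\<forall>L\<in>\<K>. bounded_below_on n f c L))"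
    unfolding eventually_frames_def
  proof (intro exI[where x = F] conjI allI impI ballI)
    fix n f e L assume "fkernel n f \<subseteq> ann F" "L \<in> \<K>"
    then show "bounded_below_on n f c L" using F(2,3) by (auto simp: bounded_below_on_def)
  qed (use F(1) in simp_all)
  then show ?thesis by (rule exI)
qed

lemma eventually_frames_pencil:
  fixes T :: "'a::real_normed_vector \<Rightarrow>\<^sub>L 'a" and a b :: real
  assumes uf: "\<And>l. l \<in> {a..b} \<Longrightarrow> upper_fredholm (T - l *\<^sub>R id_blinfun)"
  shows "\<exists>c. eventually_frames
    (\<lambda>n f e. frame n f e \<and> (\<forall>l\<in>{a..b}. bounded_below_on n f c (T - l *\<^sub>R id_blinfun)))"
proof -
  have "compact ((\<lambda>l. T - l *\<^sub>R id_blinfun) ` {a..b})"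
    by (intro compact_continuous_image continuous_intros) auto
  moreover have "upper_fredholm L" if "L \<in> (\<lambda>l. T - l *\<^sub>R id_blinfun) ` {a..b}" for L
    using that by (rule imageE) (simp only: uf)
  ultimately show ?thesis
    using eventually_frames_bounded_below[of "(\<lambda>l. T - l *\<^sub>R id_blinfun) ` {a..b}"] by simp
qed

text \<open>The operators over the rectangle of parameters form a compact set, so every sufficiently
  fine frame has the uniform lower bound that homotopy invariance asks for.\<close>

lemma ev_par_segment:
  fixes S T :: "'a::banach \<Rightarrow>\<^sub>L 'a"
  assumes le: "a \<le> b"
    and uf: "\<And>s l. s \<in> {0..1} \<Longrightarrow> l \<in> {a..b} \<Longrightarrow> upper_fredholm (S + s *\<^sub>R (T - S) - l *\<^sub>R id_blinfun)"
    and GLa: "\<And>s. s \<in> {0..1} \<Longrightarrow> S + s *\<^sub>R (T - S) - a *\<^sub>R id_blinfun \<in> GL"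
    and GLb: "\<And>s. s \<in> {0..1} \<Longrightarrow> S + s *\<^sub>R (T - S) - b *\<^sub>R id_blinfun \<in> GL"
  shows "eventually_frames (\<lambda>n f e. par n f e S a b = par n f e T a b)"
proof -
  define \<K> where "\<K> = (\<lambda>(s, l). S + s *\<^sub>R (T - S) - l *\<^sub>R id_blinfun) ` ({0..1::real} \<times> {a..b})"
  have cK: "compact \<K>" unfolding \<K>_def split_beta
    by (intro compact_continuous_image compact_Times continuous_intros) auto
  have ufK: "upper_fredholm L" if "L \<in> \<K>" for L using uf that by (auto simp: \<K>_def)
  obtain c where c: "eventually_frames (\<lambda>n f e. frame n f e \<and> (\<forall>L\<in>\<K>. bounded_below_on n f c L))"
    using eventually_frames_bounded_below[OF cK ufK] by (rule exE)
  show ?thesis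
  proof (rule eventually_frames_mono[OF c], elim conjE)
    fix n f e assume fr: "frame n f e" and below: "\<forall>L\<in>\<K>. bounded_below_on n f c L"
    show "par n f e S a b = par n f e T a b"
    proof (rule par_homotopy[where c = c])
      fix s l :: real assume "s \<in> {0..1}" "l \<in> {a..b}"
      then have "(s, l) \<in> {0..1} \<times> {a..b}" by simp
      then have "S + s *\<^sub>R (T - S) - l *\<^sub>R id_blinfun \<in> \<K>" unfolding \<K>_def by (rule rev_image_eqI) simp
      with below show "bounded_below_on n f c (S + s *\<^sub>R (T - S) - l *\<^sub>R id_blinfun)" by (rule bspec)
    qed (fact fr le GLa GLb)+
  qed
qed

text \<open>Balls are convex: two operators near \<open>T0\<close> are joined by a segment near
  \<open>T0\<close>, along which the lower bound \<open>c / 2\<close> and the invertibility at both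
  ends persist.\<close>

lemma ev_par_locally_constant:
  fixes T0 :: "'a::banach \<Rightarrow>\<^sub>L 'a"
  assumes le: "a \<le> b" and uf: "\<And>l. l \<in> {a..b} \<Longrightarrow> upper_fredholm (T0 - l *\<^sub>R id_blinfun)"
    and GL: "T0 - a *\<^sub>R id_blinfun \<in> GL" "T0 - b *\<^sub>R id_blinfun \<in> GL"
  obtains \<delta> where "0 < \<delta>"
    "\<And>S l. norm (S - T0) < \<delta> \<Longrightarrow> l \<in> {a..b} \<Longrightarrow> upper_fredholm (S - l *\<^sub>R id_blinfun)"
    "\<And>S T. norm (S - T0) < \<delta> \<Longrightarrow> norm (T - T0) < \<delta> \<Longrightarrow>
       eventually_frames (\<lambda>n f e. par n f e S a b = par n f e T a b)"
proof -
  have cK: "compact ((\<lambda>l. T0 - l *\<^sub>R id_blinfun) ` {a..b})"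
    by (intro compact_continuous_image continuous_intros) auto
  have ufK: "upper_fredholm L" if "L \<in> (\<lambda>l. T0 - l *\<^sub>R id_blinfun) ` {a..b}" for L
    using that by (rule imageE) (simp only: uf)
  obtain F c where F: "finite F" "0 < c" "\<And>L x. L \<in> (\<lambda>l. T0 - l *\<^sub>R id_blinfun) ` {a..b} \<Longrightarrow> x \<in> ann F \<Longrightarrow>
      c * norm x \<le> norm (blinfun_apply L x)"
    using compact_upper_fredholm[OF cK ufK] by blast
  obtain \<delta>a where \<delta>a: "0 < \<delta>a" "\<And>H. norm (H - (T0 - a *\<^sub>R id_blinfun)) < \<delta>a \<Longrightarrow> H \<in> GL"
    using GL_ball[OF GL(1)] by blast
  obtain \<delta>b where \<delta>b: "0 < \<delta>b" "\<And>H. norm (H - (T0 - b *\<^sub>R id_blinfun)) < \<delta>b \<Longrightarrow> H \<in> GL"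
    using GL_ball[OF GL(2)] by blast
  define \<delta> where "\<delta> = min (c / 2) (min \<delta>a \<delta>b)"
  have near_uf: "upper_fredholm (S - l *\<^sub>R id_blinfun)" if S: "norm (S - T0) < \<delta>" and l: "l \<in> {a..b}" for S l
    unfolding upper_fredholm_def
  proof (intro exI conjI ballI)
    show "finite F" "0 < c / 2" using F by auto
    fix x assume x: "x \<in> ann F"
    show "c / 2 * norm x \<le> norm (blinfun_apply (S - l *\<^sub>R id_blinfun) x)"
      by (rule bounded_below_perturb[OF F(3)[OF imageI[OF l] x]]) (use S in \<open>simp add: \<delta>_def\<close>)
  qed
  show thesis
  proof
    show "0 < \<delta>" using F(2) \<delta>a(1) \<delta>b(1) by (simp add: \<delta>_def)
    show "upper_fredholm (S - l *\<^sub>R id_blinfun)" if "norm (S - T0) < \<delta>" "l \<in> {a..b}" for S l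
      using near_uf that .
    fix S T assume ST: "norm (S - T0) < \<delta>" "norm (T - T0) < \<delta>"
    have near: "norm (S + s *\<^sub>R (T - S) - T0) < \<delta>" if "s \<in> {0..1}" for s :: real
    proof -
      have "(1 - s) *\<^sub>R S + s *\<^sub>R T \<in> ball T0 \<delta>"
        using ST that by (intro convexD[OF convex_ball]) (auto simp: dist_norm norm_minus_commute)
      then show ?thesis by (simp add: dist_norm norm_minus_commute algebra_simps)
    qed
    show "eventually_frames (\<lambda>n f e. par n f e S a b = par n f e T a b)"
    proof (rule ev_par_segment[OF le])
      fix s :: real assume s: "s \<in> {0..1}"
      show "upper_fredholm (S + s *\<^sub>R (T - S) - l *\<^sub>R id_blinfun)" if "l \<in> {a..b}" for l
        by (rule near_uf[OF near[OF s] that])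
      show "S + s *\<^sub>R (T - S) - a *\<^sub>R id_blinfun \<in> GL"
        by (rule \<delta>a(2)) (use near[OF s] in \<open>simp add: \<delta>_def\<close>)
      show "S + s *\<^sub>R (T - S) - b *\<^sub>R id_blinfun \<in> GL"
        by (rule \<delta>b(2)) (use near[OF s] in \<open>simp add: \<delta>_def\<close>)
    qed
  qed
qed

text \<open>Common approximate null vectors of non-Fredholm operators in the pencils of \<open>(1 - s) S + s T\<close> and
  \<open>(1 - s') S - s' T\<close> are, after eliminating \<open>T\<close>, approximate eigenvectors of \<open>S\<close> alone.\<close>

lemma HI_segment_alternative:
  fixes S T :: "'a::banach \<Rightarrow>\<^sub>L 'a"
  assumes HI: "hereditarily_indecomposable TYPE('a)"
    and S: "\<And>l. upper_fredholm (S - l *\<^sub>R id_blinfun)" and T: "\<And>l. upper_fredholm (T - l *\<^sub>R id_blinfun)"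
    and s: "s \<in> {0..1}" "s' \<in> {0..1}"
  shows "upper_fredholm (S + s *\<^sub>R (T - S) - l *\<^sub>R id_blinfun) \<or>
    upper_fredholm (S + s' *\<^sub>R (- T - S) - l' *\<^sub>R id_blinfun)"
proof (rule ccontr)
  define A where "A = S + s *\<^sub>R (T - S) - l *\<^sub>R id_blinfun"
  define B where "B = S + s' *\<^sub>R (- T - S) - l' *\<^sub>R id_blinfun"
  \<comment> \<open>Chosen so that \<open>s' *\<^sub>R A + s *\<^sub>R B = \<kappa> *\<^sub>R S -
    \<mu> *\<^sub>R id_blinfun\<close>: the contributions of \<open>T\<close> cancel.\<close>
  define \<kappa> where "\<kappa> = s' * (1 - s) + s * (1 - s')"
  define \<mu> where "\<mu> = s' * l + s * l'"
  assume "\<not> ?thesis"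
  then have nA: "\<not> upper_fredholm A" and nB: "\<not> upper_fredholm B" by (auto simp: A_def B_def)
  have "s \<noteq> 0 \<or> s' \<noteq> 0" using nA S[of l] by (auto simp: A_def)
  moreover have "s \<noteq> 1" using nA T[of l] by (auto simp: A_def)
  \<comment> \<open>\<kappa> vanishes only for s = s' = 0 and s = s' = 1, where \<open>A\<close>
    belongs to the pencil of \<open>S\<close> or of \<open>T\<close>.\<close>
  ultimately have "0 < \<kappa>"
    using s unfolding \<kappa>_def
    by (cases "s' = 0") (auto intro: add_pos_nonneg)
  obtain F c where F: "finite F" "0 < c"
    "\<And>x. x \<in> ann F \<Longrightarrow> c * norm x \<le> norm (blinfun_apply (S - (\<mu> / \<kappa>) *\<^sub>R id_blinfun) x)"
    using S[of "\<mu> / \<kappa>"] unfolding upper_fredholm_def by blast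
  have "0 < \<kappa> * c / 2" using \<open>0 < \<kappa>\<close> F(2) by simp
  then obtain x where x: "x \<in> ann F" "norm x = 1" "norm (blinfun_apply A x) < \<kappa> * c / 2"
    "norm (blinfun_apply B x) < \<kappa> * c / 2"
    using HI_common_small_vector[OF HI nA nB F(1)] by blast
  have "\<kappa> *\<^sub>R (S - (\<mu> / \<kappa>) *\<^sub>R id_blinfun) = \<kappa> *\<^sub>R S - \<mu> *\<^sub>R id_blinfun"
    using \<open>0 < \<kappa>\<close> by (simp add: scaleR_diff_right)
  also have "\<dots> = s' *\<^sub>R A + s *\<^sub>R B"
  proof -
    have \<kappa>: "\<kappa> *\<^sub>R S = s' *\<^sub>R S + s *\<^sub>R S - (s * s') *\<^sub>R S - (s * s') *\<^sub>R S"
      by (simp add: \<kappa>_def algebra_simps flip: scaleR_add_left)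
    show ?thesis unfolding \<kappa> by (simp add: A_def B_def \<mu>_def algebra_simps)
  qed
  finally have "\<kappa> *\<^sub>R blinfun_apply (S - (\<mu> / \<kappa>) *\<^sub>R id_blinfun) x = s' *\<^sub>R blinfun_apply A x + s *\<^sub>R blinfun_apply B x"
    by (metis blinfun.add_left blinfun.scaleR_left)
  then have "\<kappa> * norm (blinfun_apply (S - (\<mu> / \<kappa>) *\<^sub>R id_blinfun) x) =
      norm (s' *\<^sub>R blinfun_apply A x + s *\<^sub>R blinfun_apply B x)"
    using \<open>0 < \<kappa>\<close> by (metis abs_of_pos norm_scaleR)
  also have "\<dots> \<le> s' * norm (blinfun_apply A x) + s * norm (blinfun_apply B x)"
    using norm_triangle_ineq[of "s' *\<^sub>R blinfun_apply A x" "s *\<^sub>R blinfun_apply B x"] s by simp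
  also have "\<dots> \<le> norm (blinfun_apply A x) + norm (blinfun_apply B x)"
    using s by (intro add_mono mult_left_le_one_le) auto
  also have "\<dots> < \<kappa> * c" using x(3,4) by simp
  finally have "norm (blinfun_apply (S - (\<mu> / \<kappa>) *\<^sub>R id_blinfun) x) < c" using \<open>0 < \<kappa>\<close> by simp
  then show False using F(3)[OF x(1)] x(2) by simp
qed

text \<open>A single bad parameter on the segment from \<open>S\<close> to \<open>T\<close> rules
  out every bad parameter on the segment from \<open>S\<close> to \<open>- T\<close>. In that case
  the sign of \<open>T\<close> is removed afterwards, which is possible because the interval is
  symmetric about 0.\<close>

lemma ev_par_full_line:
  fixes S T :: "'a::banach \<Rightarrow>\<^sub>L 'a"
  assumes HI: "hereditarily_indecomposable TYPE('a)"
    and S: "norm S < M" "\<And>l. l \<in> {- M..M} \<Longrightarrow> upper_fredholm (S - l *\<^sub>R id_blinfun)"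
    and T: "norm T < M" "\<And>l. l \<in> {- M..M} \<Longrightarrow> upper_fredholm (T - l *\<^sub>R id_blinfun)"
  shows "eventually_frames (\<lambda>n f e. par n f e S (- M) M = par n f e T (- M) M)"
proof -
  have "0 \<le> norm S" by simp
  then have M: "0 < M" using S(1) by linarith
  then have le: "- M \<le> M" by simp
  \<comment> \<open>The alternative compares arbitrary real parameters, so Fredholmness is needed
    beyond the interval too; there the norm bound makes the pencil invertible.\<close>
  have all: "upper_fredholm (U - l *\<^sub>R id_blinfun)"
    if "norm U < M" "\<And>l. l \<in> {- M..M} \<Longrightarrow> upper_fredholm (U - l *\<^sub>R id_blinfun)" for U :: "'a \<Rightarrow>\<^sub>L 'a" and l
  proof (cases "l \<in> {- M..M}")
    case False
    then have "norm U < \<bar>l\<bar>" using that(1) by auto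
    then show ?thesis by (intro GL_upper_fredholm GL_diff_scaleR_id)
  qed (use that in blast)
  have ends: "S + s *\<^sub>R (U - S) - (- M) *\<^sub>R id_blinfun \<in> GL" "S + s *\<^sub>R (U - S) - M *\<^sub>R id_blinfun \<in> GL"
    if "norm U < M" "s \<in> {0..1}" for U :: "'a \<Rightarrow>\<^sub>L 'a" and s :: real
  proof -
    have "(1 - s) *\<^sub>R S + s *\<^sub>R U \<in> ball 0 M"
      using S(1) that by (intro convexD[OF convex_ball]) auto
    then have "norm (S + s *\<^sub>R (U - S)) < M" by (simp add: algebra_simps)
    then show "S + s *\<^sub>R (U - S) - (- M) *\<^sub>R id_blinfun \<in> GL" "S + s *\<^sub>R (U - S) - M *\<^sub>R id_blinfun \<in> GL"
      using M by (intro GL_diff_scaleR_id; simp)+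
  qed
  note alt = HI_segment_alternative[OF HI all[OF S] all[OF T]]
  show ?thesis
  proof (cases "\<forall>s\<in>{0..1}. \<forall>l. upper_fredholm (S + s *\<^sub>R (T - S) - l *\<^sub>R id_blinfun)")
    case True
    then show ?thesis using ends[OF T(1)] by (intro ev_par_segment[OF le]) auto
  next
    case False
    then have "\<forall>s\<in>{0..1}. \<forall>l. upper_fredholm (S + s *\<^sub>R (- T - S) - l *\<^sub>R id_blinfun)"
      using alt by blast
    then have 1: "eventually_frames (\<lambda>n f e. par n f e S (- M) M = par n f e (- T) (- M) M)"
      using ends[of "- T"] T(1) by (intro ev_par_segment[OF le]) auto
    obtain c where c: "eventually_frames
        (\<lambda>n f e. frame n f e \<and> (\<forall>l\<in>{- M..M}. bounded_below_on n f c (T - l *\<^sub>R id_blinfun)))"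
      using eventually_frames_pencil[OF T(2)] by (rule exE)
    have GL: "T - (- M) *\<^sub>R id_blinfun \<in> GL" "T - M *\<^sub>R id_blinfun \<in> GL"
      using T(1) M by (intro GL_diff_scaleR_id; simp)+
    have "eventually_frames (\<lambda>n f e. par n f e (- T) (- M) M = par n f e T (- M) M)"
    proof (rule eventually_frames_mono[OF c], elim conjE)
      fix n f e assume fr: "frame n f e"
        and below: "\<forall>l\<in>{- M..M}. bounded_below_on n f c (T - l *\<^sub>R id_blinfun)"
      show "par n f e (- T) (- M) M = par n f e T (- M) M"
        using par_uminus[OF fr le bspec[OF below] GL] by simp
    qed
    from eventually_frames_conj[OF 1 this] show ?thesis by (rule eventually_frames_mono) simp
  qed
qed

section \<open>Reflections\<close>

lemma reflection_form:
  fixes R :: "'a::real_normed_vector \<Rightarrow>\<^sub>L 'a"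
  assumes "reflection R"
  obtains \<phi> x0 where "blinfun_apply \<phi> x0 = 1" "R = id_blinfun - 2 *\<^sub>R rank_one \<phi> x0"
proof -
  obtain H x0 where H: "hyperplane H" and x0: "x0 \<noteq> 0" and RH: "\<And>x. x \<in> H \<Longrightarrow> blinfun_apply R x = x"
    and Rx0: "blinfun_apply R x0 = - x0"
    using assms unfolding reflection_def by blast
  obtain v where sub: "subspace H" and v: "span (insert v H) = UNIV"
    using H unfolding hyperplane_def by blast
  have spH: "span H = H" using sub by (simp only: span_eq_iff)
  have dec: "\<exists>k. y - k *\<^sub>R v \<in> H" for y
    using span_breakdown_eq[of y v H] v unfolding spH by simp
  have "x0 \<notin> H"
  proof
    assume "x0 \<in> H"
    then have "x0 = - x0" using RH Rx0 by metis
    then have "2 *\<^sub>R x0 = 0" unfolding scaleR_2 by (metis add.right_inverse)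
    then show False using x0 by simp
  qed
  obtain k0 where k0: "x0 - k0 *\<^sub>R v \<in> H" using dec by blast
  have "k0 \<noteq> 0" using k0 \<open>x0 \<notin> H\<close> by auto
  \<comment> \<open>The projection onto the line of \<open>x0\<close> along the hyperplane.\<close>
  define E where "E = (1 / 2) *\<^sub>R (id_blinfun - R)"
  have E: "\<exists>c. blinfun_apply E y = c *\<^sub>R x0" for y
  proof -
    obtain k where k: "y - k *\<^sub>R v \<in> H" using dec by blast
    define c where "c = k / k0"
    have "c *\<^sub>R (k0 *\<^sub>R v) = k *\<^sub>R v" using \<open>k0 \<noteq> 0\<close> by (simp add: c_def)
    then have eq: "y - c *\<^sub>R x0 = (y - k *\<^sub>R v) - c *\<^sub>R (x0 - k0 *\<^sub>R v)"
      unfolding scaleR_diff_right by simp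
    have "y - c *\<^sub>R x0 \<in> H" unfolding eq by (rule subspace_diff[OF sub k subspace_scale[OF sub k0]])
    then have "blinfun_apply R (y - c *\<^sub>R x0) = y - c *\<^sub>R x0" by (rule RH)
    then have "y - blinfun_apply R y = c *\<^sub>R x0 + c *\<^sub>R x0"
      by (simp add: blinfun.bilinear_simps Rx0 algebra_simps)
    then have "blinfun_apply E y = c *\<^sub>R x0"
      unfolding E_def by (simp only: blinfun.scaleR_left blinfun.diff_left blinfun_apply_id_blinfun scaleR_half_double)
    then show ?thesis by blast
  qed
  \<comment> \<open>Composing \<open>E\<close> with a bounded functional that is nonzero at
    \<open>x0\<close> gives the coefficient along \<open>x0\<close> as a bounded functional.\<close>
  obtain g :: "'a \<Rightarrow>\<^sub>L real" where g: "blinfun_apply g x0 = norm x0" using norming_functional by blast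
  define \<phi> where "\<phi> = (1 / norm x0) *\<^sub>R (g o\<^sub>L E)"
  have \<phi>: "blinfun_apply \<phi> y *\<^sub>R x0 = blinfun_apply E y" for y
  proof -
    obtain c where c: "blinfun_apply E y = c *\<^sub>R x0" using E by blast
    then show ?thesis using x0 by (simp add: \<phi>_def blinfun.bilinear_simps g)
  qed
  have "blinfun_apply E x0 = x0"
    by (simp add: E_def blinfun.bilinear_simps Rx0 flip: scaleR_2)
  then have "blinfun_apply \<phi> x0 = 1" using x0 by (simp add: \<phi>_def blinfun.bilinear_simps g)
  moreover have "R = id_blinfun - 2 *\<^sub>R rank_one \<phi> x0"
  proof (rule blinfun_eqI)
    fix y
    have "blinfun_apply R y = y - 2 *\<^sub>R blinfun_apply E y" by (simp add: E_def blinfun.bilinear_simps)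
    then show "blinfun_apply R y = blinfun_apply (id_blinfun - 2 *\<^sub>R rank_one \<phi> x0) y"
      by (simp only: blinfun.diff_left blinfun.scaleR_left rank_one_apply \<phi> blinfun_apply_id_blinfun)
  qed
  ultimately show thesis using that by blast
qed

text \<open>Adding \<open>K0\<close> turns the pencil into
  \<open>(1 - l) *\<^sub>R id_blinfun\<close>, invertible for l \<le> 0, so one corrector covers the
  interval. The determinant relative to it is (- 1 - l) / (1 - l), which changes sign exactly once,
  at the eigenvalue -1.\<close>

lemma par_reflection:
  fixes R :: "'a::banach \<Rightarrow>\<^sub>L 'a"
  assumes fr: "frame n f e" and n: "0 < n" and R: "R = id_blinfun - 2 *\<^sub>R rank_one (f 0) (e 0)"
    and "1 < M" and GL: "R \<in> GL" "R - (- M) *\<^sub>R id_blinfun \<in> GL"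
  shows "par n f e R (- M) 0 = - 1"
proof -
  define K0 where "K0 = 2 *\<^sub>R rank_one (f 0) (e 0)"
  define G :: "real \<Rightarrow> 'a \<Rightarrow>\<^sub>L 'a" where "G l = (1 - l) *\<^sub>R id_blinfun" for l
  have RK: "R - l *\<^sub>R id_blinfun + K0 = G l" for l by (simp add: R K0_def G_def algebra_simps)
  have G: "G l \<in> GL" if "l \<in> {- M..0}" for l using that by (auto simp: G_def intro: GL_scaleR id_in_GL)
  have adm: "adm n f (R - l *\<^sub>R id_blinfun) K0" if "l \<in> {- M..0}" for l
    using G[OF that] n unfolding adm_def RK by (auto simp: K0_def blinfun.bilinear_simps fkernel_def)
  have cd: "cdet n f e (G l) (R - l *\<^sub>R id_blinfun) = (- 1 - l) / (1 - l)" if l: "l \<in> {- M..0}" for l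
  proof -
    have "binv (G l) = (1 / (1 - l)) *\<^sub>R id_blinfun"
      using l by (intro binv_eqI) (simp_all add: G_def blinfun.bilinear_simps)
    moreover have v: "(- 1 - l) *\<^sub>R e 0 - blinfun_apply (G l) (e 0) = (- 2) *\<^sub>R e 0"
      by (simp add: G_def blinfun.bilinear_simps flip: scaleR_diff_left)
    have "R - l *\<^sub>R id_blinfun = G l + rank_one (f 0) ((- 1 - l) *\<^sub>R e 0 - blinfun_apply (G l) (e 0))"
      unfolding v by (rule blinfun_eqI) (simp add: R G_def blinfun.bilinear_simps algebra_simps)
    ultimately show ?thesis
      using cdet_exchange(2)[OF fr G[OF l] n] fr n by (simp add: blinfun.bilinear_simps frame_def)
  qed
  have "continuous_on {- M..0} (\<lambda>l. R - l *\<^sub>R id_blinfun)" by (intro continuous_intros)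
  from par_eqI[OF fr _ orientation_const[OF fr this adm] _ GL(2)]
  have "par n f e R (- M) 0 = sgn (cdet n f e (G (- M)) (R - (- M) *\<^sub>R id_blinfun)) *
      sgn (cdet n f e (G 0) (R - 0 *\<^sub>R id_blinfun))"
    using adm \<open>1 < M\<close> GL unfolding RK by auto
  also have "\<dots> = sgn ((- 1 + M) / (1 + M)) * sgn (- 1)"
    using cd[of "- M"] cd[of 0] \<open>1 < M\<close> by simp
  also have "\<dots> = - 1" using \<open>1 < M\<close> by (simp add: sgn_divide)
  finally show ?thesis .
qed

theorem theorem3p1:
  fixes R :: "'a::banach \<Rightarrow>\<^sub>L 'a"
  assumes "hereditarily_indecomposable TYPE('a)"
    and "reflection R"
  shows "\<not> (\<exists>T :: real \<Rightarrow> ('a \<Rightarrow>\<^sub>L 'a). continuous_on {0..1} T \<and> (\<forall>t\<in>{0..1}. T t \<in> GL) \<and>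
            T 0 = id_blinfun \<and> T 1 = R)"
proof
  note HI = assms(1)
  assume "\<exists>T :: real \<Rightarrow> ('a \<Rightarrow>\<^sub>L 'a). continuous_on {0..1} T \<and> (\<forall>t\<in>{0..1}. T t \<in> GL) \<and>
            T 0 = id_blinfun \<and> T 1 = R"
  then obtain T :: "real \<Rightarrow> ('a \<Rightarrow>\<^sub>L 'a)" where cont: "continuous_on {0..1} T"
    and GL: "\<And>t. t \<in> {0..1} \<Longrightarrow> T t \<in> GL" and T0: "T 0 = id_blinfun" and T1: "T 1 = R" by blast
  have "bounded (T ` {0..1})" by (intro compact_imp_bounded compact_continuous_image cont) simp
  then obtain M0 where M0: "\<And>t. t \<in> {0..1} \<Longrightarrow> norm (T t) \<le> M0" unfolding bounded_iff by blast
  \<comment> \<open>The added 1 makes the norm bound strict; the maximum with 1 puts the eigenvalue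
    -1 of the reflection inside the interval.\<close>
  define M where "M = max M0 1 + 1"
  have M: "1 < M" "- M \<le> 0" "0 \<le> M" by (auto simp: M_def)
  have normT: "norm (T t) < M" if "t \<in> {0..1}" for t using M0[OF that] by (simp add: M_def)
  have GLM: "T t - (- M) *\<^sub>R id_blinfun \<in> GL" "T t - M *\<^sub>R id_blinfun \<in> GL"
    "T t - 0 *\<^sub>R id_blinfun \<in> GL" if "t \<in> {0..1}" for t
  proof -
    show "T t - (- M) *\<^sub>R id_blinfun \<in> GL" "T t - M *\<^sub>R id_blinfun \<in> GL"
      using normT[OF that] M by (intro GL_diff_scaleR_id; simp)+
    show "T t - 0 *\<^sub>R id_blinfun \<in> GL" using GL[OF that] by simp
  qed
  define neg where "neg t \<longleftrightarrow> (\<forall>l\<in>{- M..0}. upper_fredholm (T t - l *\<^sub>R id_blinfun))" for t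
  define pos where "pos t \<longleftrightarrow> (\<forall>l\<in>{0..M}. upper_fredholm (T t - l *\<^sub>R id_blinfun))" for t
  have neg_or_pos: "neg t \<or> pos t" if t: "t \<in> {0..1}" for t
  proof (rule ccontr)
    assume "\<not> ?thesis"
    then obtain l l' where l: "l \<le> 0" "\<not> upper_fredholm (T t - l *\<^sub>R id_blinfun)"
      and l': "0 \<le> l'" "\<not> upper_fredholm (T t - l' *\<^sub>R id_blinfun)"
      unfolding neg_def pos_def by auto
    \<comment> \<open>Equality would force both to be 0, where the pencil is the invertible
      \<open>T t\<close> itself.\<close>
    have "l \<noteq> l'"
      using l l' GL_upper_fredholm[OF GL[OF t]] by auto
    then have "0 < (l' - l) / 2" using l(1) l'(1) by simp
    then obtain x where x: "norm x = 1" "norm (blinfun_apply (T t - l *\<^sub>R id_blinfun) x) < (l' - l) / 2"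
      "norm (blinfun_apply (T t - l' *\<^sub>R id_blinfun) x) < (l' - l) / 2"
      using HI_common_small_vector[OF HI l(2) l'(2) finite.emptyI] by metis
    \<comment> \<open>One unit vector cannot be an approximate eigenvector for two different values:
      subtracting bounds \<open>l' - l\<close> strictly by itself.\<close>
    have "(l' - l) *\<^sub>R x = blinfun_apply (T t - l *\<^sub>R id_blinfun) x - blinfun_apply (T t - l' *\<^sub>R id_blinfun) x"
      by (simp add: blinfun.bilinear_simps algebra_simps)
    then have "norm ((l' - l) *\<^sub>R x) < (l' - l) / 2 + (l' - l) / 2"
      using norm_triangle_ineq4 x(2,3) by (metis add_strict_mono order_le_less_trans)
    then show False using x(1) l(1) l'(1) by simp
  qed
  have both_uf: "upper_fredholm (T t - l *\<^sub>R id_blinfun)" if "neg t" "pos t" "l \<in> {- M..M}" for t l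
    using that unfolding neg_def pos_def by (cases "l \<le> 0") auto
  \<comment> \<open>The parity of \<open>T s\<close> along the whole interval is the switching
    factor. If no parameter satisfies both conditions, this is some fixed number about which nothing
    is claimed.\<close>
  define s where "s = (SOME s. s \<in> {0..1} \<and> neg s \<and> pos s)"
  define \<epsilon> where "\<epsilon> n f e t = (if neg t then par n f e (T t) (- M) 0
      else par n f e (T s) (- M) M * par n f e (T t) 0 M)" for n f e t
  \<comment> \<open>The case \<open>neg t\<close> takes precedence in \<epsilon>. Here the other
    formula is shown to hold wherever \<open>pos t\<close> does, so local constancy along {0..M} can
    be used whichever case applies.\<close>
  have on_pos: "eventually_frames (\<lambda>n f e. \<epsilon> n f e t = par n f e (T s) (- M) M * par n f e (T t) 0 M)"
    if t: "t \<in> {0..1}" "pos t" for t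
  proof (cases "neg t")
    case False
    then have "\<And>n f e. \<epsilon> n f e t = par n f e (T s) (- M) M * par n f e (T t) 0 M" by (simp add: \<epsilon>_def)
    then show ?thesis unfolding eventually_frames_def by (intro exI[where x = "{}"]) simp
  next
    case True
    have "s \<in> {0..1} \<and> neg s \<and> pos s" unfolding s_def by (rule someI_ex) (use t True in blast)
    then have 1: "eventually_frames (\<lambda>n f e. par n f e (T s) (- M) M = par n f e (T t) (- M) M)"
      using t True normT both_uf by (intro ev_par_full_line[OF HI]) blast+
    obtain c where c: "eventually_frames
        (\<lambda>n f e. frame n f e \<and> (\<forall>l\<in>{- M..M}. bounded_below_on n f c (T t - l *\<^sub>R id_blinfun)))"
      using eventually_frames_pencil[OF both_uf[OF True t(2)]] by (rule exE)
    \<comment> \<open>Split at 0, where \<open>T t\<close> is invertible; the factor along {0..M} is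
      its own inverse and can change sides.\<close>
    have 2: "eventually_frames (\<lambda>n f e. par n f e (T t) (- M) M = par n f e (T t) (- M) 0 * par n f e (T t) 0 M \<and>
        par n f e (T t) 0 M \<in> {1, -1})"
    proof (rule eventually_frames_mono[OF c], elim conjE)
      fix n f e assume fr: "frame n f e"
        and below: "\<forall>l\<in>{- M..M}. bounded_below_on n f c (T t - l *\<^sub>R id_blinfun)"
      have "par n f e (T t) (- M) M = par n f e (T t) (- M) 0 * par n f e (T t) 0 M"
        by (rule par_split[OF fr M(2,3) bspec[OF below] GLM(1)[OF t(1)] GLM(3)[OF t(1)] GLM(2)[OF t(1)]])
      moreover have "bounded_below_on n f c (T t - l *\<^sub>R id_blinfun)" if "l \<in> {0..M}" for l
        using below that M by auto
      then have "par n f e (T t) 0 M \<in> {1, -1}"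
        by (rule par_pm1[OF fr M(3) _ GLM(3)[OF t(1)] GLM(2)[OF t(1)]])
      ultimately show "par n f e (T t) (- M) M = par n f e (T t) (- M) 0 * par n f e (T t) 0 M \<and>
        par n f e (T t) 0 M \<in> {1, -1}" by (rule conjI)
    qed
    from eventually_frames_conj[OF 1 2] show ?thesis
      by (rule eventually_frames_mono) (auto simp: \<epsilon>_def True)
  qed
  \<comment> \<open>Membership in {0..1} is a premise because the small intervals of the bisection
    argument may stick out of it.\<close>
  define P where "P a b \<longleftrightarrow> a \<in> {0..1} \<longrightarrow> b \<in> {0..1} \<longrightarrow> eventually_frames (\<lambda>n f e. \<epsilon> n f e a = \<epsilon> n f e b)" for a b
  have "P 0 1"
  proof (rule Bolzano)
    fix a b c :: real assume P: "P a b" "P b c" "a \<le> b" "b \<le> c"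
    show "P a c" unfolding P_def
    proof (intro impI)
      assume "a \<in> {0..1}" "c \<in> {0..1}"
      then have "eventually_frames (\<lambda>n f e. \<epsilon> n f e a = \<epsilon> n f e b)" "eventually_frames (\<lambda>n f e. \<epsilon> n f e b = \<epsilon> n f e c)"
        using P by (auto simp: P_def)
      from eventually_frames_conj[OF this] show "eventually_frames (\<lambda>n f e. \<epsilon> n f e a = \<epsilon> n f e c)"
        by (rule eventually_frames_mono) simp
    qed
  next
    fix x :: real assume "0 \<le> x" "x \<le> 1"
    then have x: "x \<in> {0..1}" by simp
    have near: "\<exists>d>0. \<forall>t\<in>{0..1}. \<bar>t - x\<bar> < d \<longrightarrow> norm (T t - T x) < \<delta>" if "0 < \<delta>" for \<delta>
      using cont x that unfolding continuous_on_iff dist_norm real_norm_def by blast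
    show "\<exists>d>0. \<forall>a b. a \<le> x \<and> x \<le> b \<and> b - a < d \<longrightarrow> P a b"
    proof (cases "neg x")
      case True
      then obtain \<delta> where \<delta>: "0 < \<delta>"
        "\<And>S l. norm (S - T x) < \<delta> \<Longrightarrow> l \<in> {- M..0} \<Longrightarrow> upper_fredholm (S - l *\<^sub>R id_blinfun)"
        "\<And>S S'. norm (S - T x) < \<delta> \<Longrightarrow> norm (S' - T x) < \<delta> \<Longrightarrow>
           eventually_frames (\<lambda>n f e. par n f e S (- M) 0 = par n f e S' (- M) 0)"
        using ev_par_locally_constant[OF M(2), of "T x"] GLM[OF x] unfolding neg_def by blast
      obtain d where d: "d > 0" "\<And>t. t \<in> {0..1} \<Longrightarrow> \<bar>t - x\<bar> < d \<Longrightarrow> norm (T t - T x) < \<delta>"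
        using near[OF \<delta>(1)] by blast
      have "P a b" if "a \<le> x" "x \<le> b" "b - a < d" for a b
        unfolding P_def
      proof (intro impI)
        assume ab: "a \<in> {0..1}" "b \<in> {0..1}"
        have near: "norm (T a - T x) < \<delta>" "norm (T b - T x) < \<delta>" using d(2) ab that by auto
        then have "neg a" "neg b" using \<delta>(2) by (auto simp: neg_def)
        then show "eventually_frames (\<lambda>n f e. \<epsilon> n f e a = \<epsilon> n f e b)"
          using \<delta>(3)[OF near] by (simp add: \<epsilon>_def)
      qed
      then show ?thesis using d(1) by blast
    next
      case False
      then have "pos x" using neg_or_pos x by blast
      then obtain \<delta> where \<delta>: "0 < \<delta>"
        "\<And>S l. norm (S - T x) < \<delta> \<Longrightarrow> l \<in> {0..M} \<Longrightarrow> upper_fredholm (S - l *\<^sub>R id_blinfun)"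
        "\<And>S S'. norm (S - T x) < \<delta> \<Longrightarrow> norm (S' - T x) < \<delta> \<Longrightarrow>
           eventually_frames (\<lambda>n f e. par n f e S 0 M = par n f e S' 0 M)"
        using ev_par_locally_constant[OF M(3), of "T x"] GLM[OF x] unfolding pos_def by blast
      obtain d where d: "d > 0" "\<And>t. t \<in> {0..1} \<Longrightarrow> \<bar>t - x\<bar> < d \<Longrightarrow> norm (T t - T x) < \<delta>"
        using near[OF \<delta>(1)] by blast
      have "P a b" if "a \<le> x" "x \<le> b" "b - a < d" for a b
        unfolding P_def
      proof (intro impI)
        assume ab: "a \<in> {0..1}" "b \<in> {0..1}"
        have near: "norm (T a - T x) < \<delta>" "norm (T b - T x) < \<delta>" using d(2) ab that by auto
        then have pos: "pos a" "pos b" using \<delta>(2) by (auto simp: pos_def)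
        from eventually_frames_conj[OF eventually_frames_conj[OF on_pos[OF ab(1) pos(1)] on_pos[OF ab(2) pos(2)]] \<delta>(3)[OF near]]
        show "eventually_frames (\<lambda>n f e. \<epsilon> n f e a = \<epsilon> n f e b)"
          by (rule eventually_frames_mono) simp
      qed
      then show ?thesis using d(1) by blast
    qed
  qed simp
  then obtain F where F: "finite F"
    "\<And>n f e. frame n f e \<Longrightarrow> fkernel n f \<subseteq> ann F \<Longrightarrow> \<epsilon> n f e 0 = \<epsilon> n f e 1"
    unfolding P_def eventually_frames_def by auto
  obtain \<phi> x0 where \<phi>: "blinfun_apply \<phi> x0 = 1" "R = id_blinfun - 2 *\<^sub>R rank_one \<phi> x0"
    using reflection_form[OF assms(2)] by blast
  \<comment> \<open>The pair of the reflection starts the frame, so it keeps index 0 in the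
    refinement and the explicit parity computation applies there.\<close>
  have "frame 1 (\<lambda>_. \<phi>) (\<lambda>_. x0)" using \<phi>(1) by (simp add: frame_def)
  from frame_extend[OF F(1) this] obtain n f e where fr: "frame n f e" "1 \<le> n" "f 0 = \<phi>" "e 0 = x0" "fkernel n f \<subseteq> ann F"
    by auto
  have id: "T 0 - l *\<^sub>R id_blinfun \<in> GL" if "l \<in> {- M..0}" for l
  proof -
    have "T 0 - l *\<^sub>R id_blinfun = (1 - l) *\<^sub>R id_blinfun" by (simp add: T0 algebra_simps)
    then show ?thesis using that by (auto intro: GL_scaleR id_in_GL)
  qed
  then have "neg 0" by (auto simp: neg_def intro: GL_upper_fredholm)
  then have "\<epsilon> n f e 0 = 1" using par_GL[OF fr(1) M(2) id] by (simp add: \<epsilon>_def)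
  \<comment> \<open>On the kernel of \<phi> the pencil of \<open>R\<close> is multiplication by 1 -
    l, at least 1 for l \<le> 0.\<close>
  moreover have "neg 1" unfolding neg_def upper_fredholm_def T1
  proof (intro ballI exI conjI)
    fix l x assume l: "l \<in> {- M..0}" and x: "x \<in> ann {\<phi>}"
    have "blinfun_apply (R - l *\<^sub>R id_blinfun) x = (1 - l) *\<^sub>R x"
      using x by (simp add: \<phi>(2) ann_def blinfun.bilinear_simps algebra_simps)
    then have "norm (blinfun_apply (R - l *\<^sub>R id_blinfun) x) = (1 - l) * norm x" using l by simp
    moreover have "1 * norm x \<le> (1 - l) * norm x" using l by (intro mult_right_mono) auto
    ultimately show "1 * norm x \<le> norm (blinfun_apply (R - l *\<^sub>R id_blinfun) x)" by simp
  qed simp_all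
  then have "\<epsilon> n f e 1 = - 1"
    using par_reflection[OF fr(1), of R M] fr \<phi>(2) M(1) GL[of 1] GLM(1)[of 1] by (simp add: \<epsilon>_def T1)
  ultimately show False using F(2)[OF fr(1,5)] by simp
qed

end
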